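(* Let $z,w:\mathbb Z^2\to\hat{\mathbb C}$ be a Bäcklund pair of integrable cross-ratio maps, and consider the square lattice with face weights $(a_{i,j})_{(i,j)\in\mathbb Z^2}$ given by $$a_{i,j}=\begin{cases} z_{\frac{i+j+[i+j]_2}{2},\frac{-(i+j)+[i+j]_2}{2}} & \text{if }[i-j]_4\in\{0,3\},\\ w_{\frac{i+j+[i+j]_2}{2},\frac{-(i+j)+[i+j]_2}{2}} & \text{if }[i-j]_4\in\{1,2\}.\end{cases}$$ For $(i,j)\in\mathbb Z^2$ with $i+j\ge1$ set $(i',j'):=\bigl(\frac{i-j+[i-j]_2}{2},\frac{-(i-j)+[i-j]_2}{2}\bigr)$. Then $$z_{i,j}=\begin{cases}Y(A_{i+j-1}[z_{i',j'}],a)&\text{if }[i+j]_4\in\{0,1\},\\ Y(A_{i+j-1}[w_{i',j'}],a)&\text{if }[i+j]_4\in\{2,3\},\end{cases}\qquad w_{i,j}=\begin{cases}Y(A_{i+j-1}[z_{i',j'}],a)&\text{if }[i+j]_4\in\{2,3\},\\ Y(A_{i+j-1}[w_{i',j'}],a)&\text{if }[i+j]_4\in\{0,1\}.\end{cases}$$ Here $A_k[z_{i',j'}]$ (resp. $A_k[w_{i',j'}]$) denotes the Aztec diamond $A_k(u,v)$ centered at any face $(u,v)$ with $u+v=i-j$ and $[u-v]_4\in\{0,3\}$ (resp. $[u-v]_4\in\{1,2\}$), i.e. any face labelled $z_{i',j'}$ (resp. $w_{i',j'}$) in the definition of $a$; since $a$ is invariant under translation by $(2,-2)$, the choice does not 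matter.
   Context: $\hat{\mathbb C}=\mathbb C\cup\{\infty\}$ is identified with $\mathbb{CP}^1$, with the usual arithmetic; $[n]_q\in\{0,\dots,q-1\}$ is the residue of $n$ modulo $q$; $\operatorname{cr}(a,b,c,d)=\frac{(a-b)(c-d)}{(b-c)(d-a)}$. Let $\alpha,\beta:\mathbb Z\to\mathbb C\setminus\{0\}$ (edge-labels) and $\gamma\in\mathbb C\setminus\{0\}$. An integrable cross-ratio map is a map $z:\mathbb Z^2\to\hat{\mathbb C}$ with $\operatorname{cr}(z_{i,j},z_{i+1,j},z_{i+1,j+1},z_{i,j+1})=\alpha_i/\beta_j$ for all $(i,j)$. A Bäcklund pair is a pair $z,w$ of integrable cross-ratio maps (same $\alpha,\beta$) such that for all $(i,j)$, $\operatorname{cr}(z_{i,j},z_{i+1,j},w_{i+1,j},w_{i,j})=\alpha_i/\gamma$ and $\operatorname{cr}(z_{i,j},z_{i,j+1},w_{i,j+1},w_{i,j})=\beta_j/\gamma$. Ratio function of oriented dimers. Consider the square lattice whose faces are the unit squares centered at the points of $\mathbb Z^2$, face $(i,j)$ carrying the weight $a_{i,j}$. For $k\ge1$, the Aztec diamond $A_k(i,j)$ is the subgraph formed by the vertices and edges of its internal faces, which are the faces $(i',j')$ with $|i'-i|+|j'-j|<k$; its open faces are the $(i',j')$ with $|i'-i|+|j'-j|=k$; $F$ is the set of all internal and open faces. The graph is bipartite. A Kasteleyn orientation is a skew-symmetric function $\varphi$ from directed edges to $\{-1,1\}$ such that for every internal face $f$, $\prod_{wb\in\partial f}\varphi_{(w,b)}=-1$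 (product over the four boundary edges, each directed from white to black). An oriented dimer configuration $\vec{M}$ is a set of directed edges whose undirected version is a perfect matching (each matched edge carrying exactly one direction). Its weight is $\prod_{\vec e\in\vec M}\varphi_{\vec e}\,a_{f(\vec e)}$, where $f(\vec e)\in F$ is the face to the right of $\vec e$. $Z(A,a,\varphi)$ is the sum of the weights of all oriented dimer configurations of $A$, and $Y(A,a)=\bigl(\prod_{f\in F}a_f\bigr)\frac{Z(A,a^{-1},\varphi)}{Z(A,a,\varphi)}$, where $a^{-1}$ denotes the inverse face weights; this does not depend on $\varphi$. For size $0$, $Y(A_0(i,j),a)=a_{i,j}$. $Y$ is regarded as a rational function of the face weights. Standing assumption: the data are generic, so that all expressions are well defined. *)

theory Defs
  imports "HOL-Analysis.Analysis"
begin

section \<open>The Riemann sphere and cross-ratios\<close>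

text \<open>The point \<^term>\<open>None\<close> is infinity; the topology is that of the one-point compactification.\<close>

type_synonym sphere = "complex option"

definition sphere_top :: "sphere topology" where
  "sphere_top = Alexandroff_compactification euclidean"

text \<open>Homogeneous coordinates are x : 1 for a finite point x and 1 : 0 for infinity, so that
  \<open>hdiff p q\<close> is p - q for finite points, and the factors at infinity cancel in a
  cross-ratio. This is the usual arithmetic with infinity.\<close>

fun hcoord :: "sphere \<Rightarrow> complex \<times> complex" where
  "hcoord (Some x) = (x, 1)"
| "hcoord None = (1, 0)"

definition hdiff :: "sphere \<Rightarrow> sphere \<Rightarrow> complex" where
  "hdiff p q = fst (hcoord p) * snd (hcoord q) - fst (hcoord q) * snd (hcoord p)"

text \<open>In the undefined case 0 / 0 the value is \<^term>\<open>None\<close>. Hence an equation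
  \<open>cr a b c d = Some l\<close> includes the assertion that the cross-ratio is well defined.\<close>

definition cr :: "sphere \<Rightarrow> sphere \<Rightarrow> sphere \<Rightarrow> sphere \<Rightarrow> sphere" where
  "cr a b c d =
     (if hdiff b c * hdiff d a = 0 then None
      else Some ((hdiff a b * hdiff c d) / (hdiff b c * hdiff d a)))"

definition integrable_cr_map ::
    "(int \<Rightarrow> complex) \<Rightarrow> (int \<Rightarrow> complex) \<Rightarrow> (int \<Rightarrow> int \<Rightarrow> sphere) \<Rightarrow> bool" where
  "integrable_cr_map \<alpha> \<beta> z \<longleftrightarrow>
     (\<forall>i j. cr (z i j) (z (i+1) j) (z (i+1) (j+1)) (z i (j+1)) = Some (\<alpha> i / \<beta> j))"

definition baecklund_pair ::
    "(int \<Rightarrow> complex) \<Rightarrow> (int \<Rightarrow> complex) \<Rightarrow> complex \<Rightarrow>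
     (int \<Rightarrow> int \<Rightarrow> sphere) \<Rightarrow> (int \<Rightarrow> int \<Rightarrow> sphere) \<Rightarrow> bool" where
  "baecklund_pair \<alpha> \<beta> \<gamma> z w \<longleftrightarrow>
     integrable_cr_map \<alpha> \<beta> z \<and> integrable_cr_map \<alpha> \<beta> w \<and>
     (\<forall>i j. cr (z i j) (z (i+1) j) (w (i+1) j) (w i j) = Some (\<alpha> i / \<gamma>)) \<and>
     (\<forall>i j. cr (z i j) (z i (j+1)) (w i (j+1)) (w i j) = Some (\<beta> j / \<gamma>))"


section \<open>Aztec diamonds\<close>

text \<open>Face (i, j) is the unit square centred at (i, j); vertex (p, q) is the point
  (p + 1/2, q + 1/2).\<close>

type_synonym face = "int \<times> int"
type_synonym vertex = "int \<times> int"
type_synonym dart = "vertex \<times> vertex"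

fun corners :: "face \<Rightarrow> vertex set" where
  "corners (i, j) = {i - 1, i} \<times> {j - 1, j}"

fun adjacent :: "vertex \<Rightarrow> vertex \<Rightarrow> bool" where
  "adjacent (p, q) (r, s) \<longleftrightarrow> \<bar>p - r\<bar> + \<bar>q - s\<bar> = 1"

text \<open>The boundary edges of a face, in both directions.\<close>

definition boundary :: "face \<Rightarrow> dart set" where
  "boundary f = {(x, y). x \<in> corners f \<and> y \<in> corners f \<and> adjacent x y}"

fun fdist :: "face \<Rightarrow> face \<Rightarrow> int" where
  "fdist (i, j) (i', j') = \<bar>i' - i\<bar> + \<bar>j' - j\<bar>"

definition internal_faces :: "nat \<Rightarrow> face \<Rightarrow> face set" where
  "internal_faces k c = {f. fdist c f < int k}"

definition open_faces :: "nat \<Rightarrow> face \<Rightarrow> face set" where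
  "open_faces k c = {f. fdist c f = int k}"

definition all_faces :: "nat \<Rightarrow> face \<Rightarrow> face set" where
  "all_faces k c = internal_faces k c \<union> open_faces k c"

definition aztec_vertices :: "nat \<Rightarrow> face \<Rightarrow> vertex set" where
  "aztec_vertices k c = (\<Union>f\<in>internal_faces k c. corners f)"

definition aztec_darts :: "nat \<Rightarrow> face \<Rightarrow> dart set" where
  "aztec_darts k c = (\<Union>f\<in>internal_faces k c. boundary f)"

fun white :: "vertex \<Rightarrow> bool" where
  "white (p, q) \<longleftrightarrow> even (p + q)"

text \<open>The midpoint ((p+r+1)/2, (q+s+1)/2) of the edge, moved by half the direction
  (r-p, s-q) rotated clockwise by a right angle.\<close>

fun right_face :: "dart \<Rightarrow> face" where
  "right_face ((p, q), (r, s)) =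
     ((p + r + 1 + (s - q)) div 2, (q + s + 1 - (r - p)) div 2)"


section \<open>Oriented dimers and the ratio function\<close>

definition kasteleyn :: "nat \<Rightarrow> face \<Rightarrow> (dart \<Rightarrow> int) \<Rightarrow> bool" where
  "kasteleyn k c \<phi> \<longleftrightarrow>
     (\<forall>(x, y)\<in>aztec_darts k c. \<phi> (x, y) \<in> {-1, 1} \<and> \<phi> (y, x) = - \<phi> (x, y)) \<and>
     (\<forall>f\<in>internal_faces k c. (\<Prod>e | e \<in> boundary f \<and> white (fst e). \<phi> e) = -1)"

text \<open>Each vertex is an end of exactly one directed edge, so a matched edge is present in only
  one of its two directions.\<close>

definition oriented_dimers :: "nat \<Rightarrow> face \<Rightarrow> dart set set" where
  "oriented_dimers k c =
     {M. M \<subseteq> aztec_darts k c \<and>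
         (\<forall>v\<in>aztec_vertices k c. \<exists>!e. e \<in> M \<and> (v = fst e \<or> v = snd e))}"

definition partition_function ::
    "(dart \<Rightarrow> int) \<Rightarrow> nat \<Rightarrow> face \<Rightarrow> (face \<Rightarrow> complex) \<Rightarrow> complex" where
  "partition_function \<phi> k c a =
     (\<Sum>M\<in>oriented_dimers k c. \<Prod>e\<in>M. of_int (\<phi> e) * a (right_face e))"

definition admissible_weights ::
    "(dart \<Rightarrow> int) \<Rightarrow> nat \<Rightarrow> face \<Rightarrow> (face \<Rightarrow> complex) \<Rightarrow> bool" where
  "admissible_weights \<phi> k c a \<longleftrightarrow>
     (\<forall>f\<in>all_faces k c. a f \<noteq> 0) \<and> partition_function \<phi> k c a \<noteq> 0"

text \<open>The defining formula, meaningful for admissible weights.\<close>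

definition finite_ratio ::
    "(dart \<Rightarrow> int) \<Rightarrow> nat \<Rightarrow> face \<Rightarrow> (face \<Rightarrow> complex) \<Rightarrow> complex" where
  "finite_ratio \<phi> k c a =
     (\<Prod>f\<in>all_faces k c. a f) *
     partition_function \<phi> k c (\<lambda>f. inverse (a f)) / partition_function \<phi> k c a"

text \<open>As a rational function of independent weights on the faces, the ratio function takes values
  also at sphere-valued weights: its value, where defined, is that of its continuous extension from
  the dense set of admissible weights. For admissible weights this is the formula above, see
  \<open>ratio_function_admissible\<close> below.\<close>

definition ratio_function ::
    "(dart \<Rightarrow> int) \<Rightarrow> nat \<Rightarrow> face \<Rightarrow> (face \<Rightarrow> sphere) \<Rightarrow> sphere" where
  "ratio_function \<phi> k c a =
     (if k = 0 then a c
      else THE y. \<forall>b :: nat \<Rightarrow> face \<Rightarrow> complex.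
        (\<forall>n. admissible_weights \<phi> k c (b n)) \<and>
        (\<forall>f\<in>all_faces k c. limitin sphere_top (\<lambda>n. Some (b n f)) (a f) sequentially)
        \<longrightarrow> limitin sphere_top (\<lambda>n. Some (finite_ratio \<phi> k c (b n))) y sequentially)"


section \<open>Initial data\<close>

definition z_faces :: "int \<Rightarrow> face set" where
  "z_faces s = {(u, v). u + v = s \<and> (u - v) mod 4 \<in> {0, 3}}"

definition w_faces :: "int \<Rightarrow> face set" where
  "w_faces s = {(u, v). u + v = s \<and> (u - v) mod 4 \<in> {1, 2}}"

fun baecklund_weights ::
    "(int \<Rightarrow> int \<Rightarrow> sphere) \<Rightarrow> (int \<Rightarrow> int \<Rightarrow> sphere) \<Rightarrow> face \<Rightarrow> sphere" where
  "baecklund_weights z w (i, j) =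
     (let p = (i + j + (i + j) mod 2) div 2; q = (- (i + j) + (i + j) mod 2) div 2
      in if (i - j) mod 4 \<in> {0, 3} then z p q else w p q)"


section \<open>Consistency of the definitions\<close>

lemma boundary_white:
  "{e. e \<in> boundary (i, j) \<and> white (fst e)} =
     (if even (i + j)
      then {((i, j), (i - 1, j)), ((i, j), (i, j - 1)),
            ((i - 1, j - 1), (i, j - 1)), ((i - 1, j - 1), (i - 1, j))}
      else {((i - 1, j), (i, j)), ((i - 1, j), (i - 1, j - 1)),
            ((i, j - 1), (i - 1, j - 1)), ((i, j - 1), (i, j))})"
  unfolding boundary_def by (auto split: if_splits)

lemma kasteleyn_exists: "\<exists>\<phi>. kasteleyn k c \<phi>"
proof -
  define \<phi> :: "dart \<Rightarrow> int" where
    "\<phi> = (\<lambda>(x, y). if white x then (if fst y = fst x + 1 then -1 else 1)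
                     else (if fst x = fst y + 1 then 1 else -1))"
  have "(\<Prod>e | e \<in> boundary f \<and> white (fst e). \<phi> e) = -1" for f
  proof (cases f)
    case (Pair i j)
    show ?thesis
      unfolding Pair boundary_white by (auto simp: \<phi>_def)
  qed
  moreover have "\<phi> (x, y) \<in> {-1, 1} \<and> \<phi> (y, x) = - \<phi> (x, y)" if "(x, y) \<in> aztec_darts k c" for x y
  proof -
    have "adjacent x y"
      using that by (auto simp: aztec_darts_def boundary_def)
    then have "white x \<longleftrightarrow> \<not> white y"
      by (cases x; cases y) (simp; presburger)
    then show ?thesis
      by (auto simp: \<phi>_def)
  qed
  ultimately have "kasteleyn k c \<phi>"
    unfolding kasteleyn_def by blast
  then show ?thesis
    by blast
qed

lemma finite_all_faces: "finite (all_faces k c)"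
proof (cases c)
  case (Pair i j)
  have "all_faces k c \<subseteq> {i - int k..i + int k} \<times> {j - int k..j + int k}"
    unfolding Pair all_faces_def internal_faces_def open_faces_def by auto
  then show ?thesis
    by (rule finite_subset) auto
qed

lemma right_face_in_all_faces:
  assumes "e \<in> aztec_darts k c"
  shows "right_face e \<in> all_faces k c"
proof -
  obtain f where f: "f \<in> internal_faces k c" and e: "e \<in> boundary f"
    using assms by (auto simp: aztec_darts_def)
  obtain i j where [simp]: "f = (i, j)" by (cases f)
  obtain u v where [simp]: "c = (u, v)" by (cases c)
  have "right_face e \<in> {(i, j), (i + 1, j), (i - 1, j), (i, j + 1), (i, j - 1)}"
    using e by (auto simp: boundary_def)
  then show ?thesis
    using f by (auto simp: all_faces_def internal_faces_def open_faces_def)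
qed

lemma limitin_sphere_Some:
  "limitin sphere_top (\<lambda>n. Some (x n)) (Some l) F \<longleftrightarrow> (x \<longlongrightarrow> l) F"
proof
  assume L: "limitin sphere_top (\<lambda>n. Some (x n)) (Some l) F"
  show "(x \<longlongrightarrow> l) F"
  proof (rule topological_tendstoI)
    fix S :: "complex set" assume "open S" "l \<in> S"
    then have "openin sphere_top (Some ` S)" "Some l \<in> Some ` S"
      by (auto simp: sphere_top_def)
    then have "eventually (\<lambda>n. Some (x n) \<in> Some ` S) F"
      by (rule limitinD[OF L])
    then show "eventually (\<lambda>n. x n \<in> S) F"
      by (simp add: inj_image_mem_iff)
  qed
next
  assume "(x \<longlongrightarrow> l) F"
  then show "limitin sphere_top (\<lambda>n. Some (x n)) (Some l) F"
    using continuous_map_limit[OF continuous_map_Some, of euclidean x l F]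
    by (simp add: sphere_top_def o_def)
qed

lemma topspace_sphere_top [simp]: "topspace sphere_top = UNIV"
  by (auto simp: sphere_top_def notin_range_Some)

lemma Hausdorff_sphere_top: "Hausdorff_space sphere_top"
  by (simp add: sphere_top_def Hausdorff_space_Alexandroff_compactification
      locally_compact_space_euclidean)

lemma ratio_function_admissible:
  assumes "admissible_weights \<phi> k c a"
  shows "ratio_function \<phi> k c (\<lambda>f. Some (a f)) = Some (finite_ratio \<phi> k c a)"
proof (cases "k = 0")
  case True
  have "all_faces 0 c = {c}" "aztec_darts 0 c = {}" "aztec_vertices 0 c = {}"
    by (cases c; auto simp: all_faces_def internal_faces_def open_faces_def aztec_darts_def
        aztec_vertices_def)+
  then show ?thesis
    by (simp add: True ratio_function_def finite_ratio_def partition_function_def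
        oriented_dimers_def)
next
  case False
  have lim_Z: "(\<lambda>n. partition_function \<phi> k c (b n)) \<longlonglongrightarrow> partition_function \<phi> k c d"
    if "\<And>f. f \<in> all_faces k c \<Longrightarrow> (\<lambda>n. b n f) \<longlonglongrightarrow> d f" for b :: "nat \<Rightarrow> face \<Rightarrow> complex" and d
    unfolding partition_function_def
    by (intro tendsto_intros that right_face_in_all_faces) (auto simp: oriented_dimers_def)
  have lim: "(\<lambda>n. finite_ratio \<phi> k c (b n)) \<longlonglongrightarrow> finite_ratio \<phi> k c a"
    if "\<And>f. f \<in> all_faces k c \<Longrightarrow> (\<lambda>n. b n f) \<longlonglongrightarrow> a f" for b
    unfolding finite_ratio_def using assms that
    by (intro tendsto_intros lim_Z) (auto simp: admissible_weights_def)
  have "(THE y. \<forall>b. (\<forall>n. admissible_weights \<phi> k c (b n)) \<and>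
        (\<forall>f\<in>all_faces k c. limitin sphere_top (\<lambda>n. Some (b n f)) (Some (a f)) sequentially)
        \<longrightarrow> limitin sphere_top (\<lambda>n. Some (finite_ratio \<phi> k c (b n))) y sequentially) =
      Some (finite_ratio \<phi> k c a)"
  proof (rule the_equality, goal_cases)
    case 1
    show ?case
      using lim by (simp add: limitin_sphere_Some)
  next
    case (2 y)
    have "limitin sphere_top (\<lambda>n. Some (finite_ratio \<phi> k c a)) y sequentially"
      using 2[rule_format, of "\<lambda>_. a"] assms by (simp add: limitin_sphere_Some)
    moreover have "limitin sphere_top (\<lambda>n. Some (finite_ratio \<phi> k c a))
        (Some (finite_ratio \<phi> k c a)) sequentially"
      by (simp add: limitin_sphere_Some)
    ultimately show ?case
      using limitin_Hausdorff_unique[OF _ _ _ Hausdorff_sphere_top] trivial_limit_sequentially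
      by blast
  qed
  then show ?thesis
    using False by (simp add: ratio_function_def)
qed

end

(* Write c' for the dSKP value at a face with weight c and neighbours n, e, s, w. One time step
   replaces c by c' at every second face of an Aztec diamond and shrinks the diamond by one. For
   oriented dimers this is urban renewal: the diamond is the union of the 4-cycles around these
   faces, and on each 4-cycle the set of covered corners can be exchanged for its complement, at the
   price of a factor and of replacing every edge weight by the opposite one. Since
     c' - n = (n - e) (n - w) (c - s) / D,
   where D is the denominator of c', the new edge weights are those of the new face weights with
   the same Kasteleyn signs, up to a gauge at the vertices. The same holds for the inverse
   weights, and all factors cancel in the ratio function; hence Y(A_{k+1}, a) = Y(A_k, a') for
   generic weights. A Baecklund pair solves the dSKP equation in the time direction i + j,
   because on each of its cubes the cross-ratios of the three faces at w combine to the multi-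
   ratio of the six vertices other than w and its opposite. Finally, the dSKP map is continuous
   at this solution even where points are infinite, and the weights 2^i 3^j, which are stationary
   under the time step, show that generic weights are dense. *)

theory Submission
  imports Defs
begin

subsection \<open>Directed perfect matchings\<close>

text \<open>At sphere-valued weights the ratio function is a limit over all sequences of admissible
  weights, but admissibility does not make the time step possible: opposite weights at a vertex may
  agree, or c' may be zero or infinite. So in each induction step every term of the sequence is
  first moved by less than 1/(n+1) to generic weights whose ratio is equally close. The limit
  survives, and the evolved weights are admissible for the smaller diamond. All conditions involved
  are polynomial, so one point where they hold suffices, including the nonvanishing of the partition
  function for an arbitrary Kasteleyn orientation. The orientation is fixed throughout and never
  normalised.

  The parameter \<open>s\<close> is a time: faces with i + j + s even carry the value of time s and
  evolve, the others already carry that of time s + 1.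

  For c' to converge, the multi-ratio equation must determine c' at the limiting points. This is
  where distinct diagonals enter; the ends of a diagonal coincide only if the cross-ratio of the
  face is 1.\<close>

definition ends :: "'a \<times> 'a \<Rightarrow> 'a set" where
  "ends e = {fst e, snd e}"

text \<open>Darts must stay inside \<open>V\<close>, so one dart set can be matched on any subset of
  its vertices: a four-cycle on some of its corners, and the small diamond inside the dart set of
  the large one.\<close>

definition perfect_matchings :: "('a \<times> 'a) set \<Rightarrow> 'a set \<Rightarrow> ('a \<times> 'a) set set" where
  "perfect_matchings E V =
     {M. M \<subseteq> E \<and> (\<forall>e\<in>M. ends e \<subseteq> V) \<and> (\<forall>v\<in>V. \<exists>!e. e \<in> M \<and> v \<in> ends e)}"

definition matching_sum ::
    "('a \<times> 'a) set \<Rightarrow> 'a set \<Rightarrow> ('a \<times> 'a \<Rightarrow> 'b :: comm_ring_1) \<Rightarrow> 'b" where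
  "matching_sum E V y = (\<Sum>M\<in>perfect_matchings E V. \<Prod>e\<in>M. y e)"

lemma ends_Pair [simp]: "ends (u, v) = {u, v}"
  by (simp add: ends_def)

lemma perfect_matchingsI:
  assumes "M \<subseteq> E" "\<And>e. e \<in> M \<Longrightarrow> ends e \<subseteq> V" "\<And>v. v \<in> V \<Longrightarrow> \<exists>e\<in>M. v \<in> ends e"
    and "\<And>v e e'. e \<in> M \<Longrightarrow> e' \<in> M \<Longrightarrow> v \<in> ends e \<Longrightarrow> v \<in> ends e' \<Longrightarrow> e = e'"
  shows "M \<in> perfect_matchings E V"
  unfolding perfect_matchings_def using assms by blast

lemma perfect_matchingsD:
  assumes "M \<in> perfect_matchings E V"
  shows "M \<subseteq> E" "\<And>e. e \<in> M \<Longrightarrow> ends e \<subseteq> V" "\<And>v. v \<in> V \<Longrightarrow> \<exists>e\<in>M. v \<in> ends e"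
    and "\<And>v e e'. e \<in> M \<Longrightarrow> e' \<in> M \<Longrightarrow> v \<in> ends e \<Longrightarrow> v \<in> ends e' \<Longrightarrow> e = e'"
proof -
  show "M \<subseteq> E" and ends: "\<And>e. e \<in> M \<Longrightarrow> ends e \<subseteq> V" and "\<And>v. v \<in> V \<Longrightarrow> \<exists>e\<in>M. v \<in> ends e"
    using assms unfolding perfect_matchings_def by blast+
  fix v e e' assume *: "e \<in> M" "e' \<in> M" "v \<in> ends e" "v \<in> ends e'"
  then have "v \<in> V" using ends by blast
  then have "\<exists>!e. e \<in> M \<and> v \<in> ends e"
    using assms unfolding perfect_matchings_def by blast
  then show "e = e'" using * by blast
qed

lemma finite_perfect_matchings: "finite E \<Longrightarrow> finite (perfect_matchings E V)"
  by (rule finite_subset[of _ "Pow E"]) (auto dest: perfect_matchingsD(1))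

lemma matching_sum_empty: "matching_sum E {} y = 1"
proof -
  have "perfect_matchings E {} = {{}}"
    by (auto simp: perfect_matchings_def ends_def)
  then show ?thesis
    by (simp add: matching_sum_def)
qed

lemma matching_sum_restrict:
  assumes "E \<subseteq> E'" and "\<And>e. e \<in> E' \<Longrightarrow> ends e \<subseteq> V \<Longrightarrow> e \<in> E"
  shows "matching_sum E V y = matching_sum E' V y"
proof -
  have "perfect_matchings E V = perfect_matchings E' V"
    using assms unfolding perfect_matchings_def by blast
  then show ?thesis
    by (simp add: matching_sum_def)
qed

text \<open>In a perfect matching the sets \<open>ends e\<close> partition \<open>V\<close>, so each
  factor \<open>g v\<close> occurs exactly once, whatever the matching.\<close>

lemma matching_sum_gauge:
  assumes "finite V" and loop: "\<And>e. e \<in> E \<Longrightarrow> fst e \<noteq> snd e"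
    and y: "\<And>e. e \<in> E \<Longrightarrow> ends e \<subseteq> V \<Longrightarrow> y' e = g (fst e) * g (snd e) * y e"
  shows "matching_sum E V y' = (\<Prod>v\<in>V. g v) * matching_sum E V y"
proof -
  have "(\<Prod>e\<in>M. y' e) = (\<Prod>v\<in>V. g v) * (\<Prod>e\<in>M. y e)" if M: "M \<in> perfect_matchings E V" for M
  proof -
    note D = perfect_matchingsD[OF M]
    have V: "V = (\<Union>e\<in>M. ends e)"
      using D(2,3) by blast
    have disj: "\<forall>e\<in>M. \<forall>e'\<in>M. e \<noteq> e' \<longrightarrow> ends e \<inter> ends e' = {}"
      using D(4) by blast
    have fin: "finite M"
    proof (rule inj_on_finite)
      show "inj_on fst M"
        by (rule inj_onI, rule D(4)) (auto simp: ends_def)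
      show "fst ` M \<subseteq> V" using D(2) by (auto simp: ends_def)
    qed fact
    have "(\<Prod>v\<in>V. g v) = (\<Prod>e\<in>M. \<Prod>v\<in>ends e. g v)"
      unfolding V by (rule prod.UNION_disjoint) (use fin disj in \<open>auto simp: ends_def\<close>)
    also have "\<dots> = (\<Prod>e\<in>M. g (fst e) * g (snd e))"
    proof (rule prod.cong)
      fix e assume "e \<in> M"
      then have "fst e \<noteq> snd e" using D(1) loop by blast
      then show "(\<Prod>v\<in>ends e. g v) = g (fst e) * g (snd e)" by (simp add: ends_def)
    qed simp
    finally have "(\<Prod>v\<in>V. g v) * (\<Prod>e\<in>M. y e) = (\<Prod>e\<in>M. g (fst e) * g (snd e) * y e)"
      by (simp add: prod.distrib)
    also have "\<dots> = (\<Prod>e\<in>M. y' e)"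
      using D(1,2) y by (intro prod.cong) (metis subsetD)+
    finally show ?thesis ..
  qed
  then show ?thesis
    by (simp add: matching_sum_def sum_distrib_left)
qed

text \<open>Expansion over the dart that covers \<open>v\<close>: deleting it leaves a perfect
  matching of the remaining vertices, and inserting it undoes this.\<close>

lemma matching_sum_step:
  assumes "finite E" "v \<in> V"
  shows "matching_sum E V y =
    (\<Sum>e\<in>{e\<in>E. v \<in> ends e \<and> ends e \<subseteq> V}. y e * matching_sum E (V - ends e) y)"
    (is "_ = sum _ ?D")
proof -
  let ?B = "\<lambda>e. perfect_matchings E (V - ends e)"
  let ?edge = "\<lambda>M. THE e. e \<in> M \<and> v \<in> ends e"
  have "(\<Sum>e\<in>?D. y e * matching_sum E (V - ends e) y) =
      (\<Sum>e\<in>?D. \<Sum>M\<in>?B e. y e * (\<Prod>e\<in>M. y e))"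
    by (simp add: matching_sum_def sum_distrib_left)
  also have "\<dots> = (\<Sum>(e, M)\<in>Sigma ?D ?B. y e * (\<Prod>e\<in>M. y e))"
    using assms by (intro sum.Sigma) (auto intro: finite_perfect_matchings)
  also have "\<dots> = (\<Sum>M\<in>perfect_matchings E V. \<Prod>e\<in>M. y e)"
  proof (rule sum.reindex_bij_witness[where
        i = "\<lambda>M. (?edge M, M - {?edge M})" and j = "\<lambda>(e, M). insert e M"], goal_cases)
    case (1 a)
    obtain e M where a: "a = (e, M)" by (cases a)
    have e: "v \<in> ends e" and M: "M \<in> ?B e"
      using 1 a by auto
    note D = perfect_matchingsD[OF M]
    have notin: "e \<notin> M" using D(2) e by blast
    have "?edge (insert e M) = e"
      using D(2) e by (intro the_equality) auto
    then show ?case using notin by (simp add: a)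
  next
    case (2 a)
    obtain e M where a: "a = (e, M)" by (cases a)
    have e: "e \<in> E" "v \<in> ends e" "ends e \<subseteq> V" and M: "M \<in> ?B e"
      using 2 a by auto
    note D = perfect_matchingsD[OF M]
    have "insert e M \<in> perfect_matchings E V"
    proof (rule perfect_matchingsI)
      fix v' e1 e2 assume *: "e1 \<in> insert e M" "e2 \<in> insert e M" "v' \<in> ends e1" "v' \<in> ends e2"
      show "e1 = e2"
        using * D(2)[of e1] D(2)[of e2] D(4)[of e1 e2 v'] by blast
    next
      fix v' assume "v' \<in> V"
      then show "\<exists>e'\<in>insert e M. v' \<in> ends e'"
        using D(3)[of v'] by blast
    qed (use D(1,2) e in blast)+
    then show ?case by (simp add: a)
  next
    case (3 M)
    note D = perfect_matchingsD[OF 3]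
    have "\<exists>!e. e \<in> M \<and> v \<in> ends e"
      using D(3,4) assms(2) by blast
    from theI'[OF this] show ?case by auto
  next
    case (4 M)
    note D = perfect_matchingsD[OF 4]
    have ex: "\<exists>!e. e \<in> M \<and> v \<in> ends e"
      using D(3,4) assms(2) by blast
    define e where "e = ?edge M"
    have e: "e \<in> M" "v \<in> ends e"
      using theI'[OF ex] by (auto simp: e_def)
    have "M - {e} \<in> ?B e"
    proof (rule perfect_matchingsI)
      fix e' assume e': "e' \<in> M - {e}"
      then have "ends e' \<inter> ends e = {}" using D(4)[of e' e] e by blast
      then show "ends e' \<subseteq> V - ends e" using D(2) e' by blast
    next
      fix v' assume "v' \<in> V - ends e"
      then show "\<exists>e'\<in>M - {e}. v' \<in> ends e'"
        using D(3)[of v'] by blast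
    qed (use D in blast)+
    moreover have "e \<in> E" "ends e \<subseteq> V"
      using e D(1,2) by blast+
    ultimately show ?case using e by (auto simp flip: e_def)
  next
    case (5 a)
    obtain e M where a: "a = (e, M)" by (cases a)
    have e: "v \<in> ends e" and M: "M \<in> ?B e"
      using 5 a by auto
    note D = perfect_matchingsD[OF M]
    have "e \<notin> M" "finite M"
      using D(1,2) e assms(1) by (blast, meson finite_subset)
    then show ?case by (simp add: a)
  qed
  finally show ?thesis by (simp add: matching_sum_def)
qed

text \<open>The pieces may share vertices but no darts. A matching therefore splits uniquely:
  \<open>h f\<close> records the vertices covered within piece \<open>f\<close>, each vertex of
  \<open>V\<close> falls to exactly one piece, and the pieces are then matched
  independently.\<close>

lemma matching_sum_UN:
  assumes F: "finite F" and E: "\<And>f. f \<in> F \<Longrightarrow> finite (E f)" and C: "\<And>f. finite (C f)"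
    and disj: "disjoint_family_on E F"
    and ends: "\<And>f e. f \<in> F \<Longrightarrow> e \<in> E f \<Longrightarrow> ends e \<subseteq> C f"
  shows "matching_sum (\<Union>f\<in>F. E f) V y =
    (\<Sum>h\<in>{h\<in>PiE F (\<lambda>f. Pow (C f)). (\<forall>f\<in>F. h f \<subseteq> V) \<and> (\<forall>v\<in>V. \<exists>!f. f \<in> F \<and> v \<in> h f)}.
       \<Prod>f\<in>F. matching_sum (E f) (h f) y)" (is "_ = sum _ ?H")
proof -
  let ?P = "\<lambda>h. PiE F (\<lambda>f. perfect_matchings (E f) (h f))"
  let ?I = "\<lambda>M. \<Union>e\<in>M. ends e"
  have E_unique: "f = f'" if "f \<in> F" "f' \<in> F" "e \<in> E f" "e \<in> E f'" for e f f'
    using that disj unfolding disjoint_family_on_def by blast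
  have finH: "finite ?H"
    by (rule finite_subset[of _ "PiE F (\<lambda>f. Pow (C f))"]) (use F C in \<open>auto intro!: finite_PiE\<close>)
  have "(\<Sum>h\<in>?H. \<Prod>f\<in>F. matching_sum (E f) (h f) y) =
      (\<Sum>h\<in>?H. \<Sum>d\<in>?P h. \<Prod>f\<in>F. \<Prod>e\<in>d f. y e)"
  proof (rule sum.cong[OF refl])
    fix h
    show "(\<Prod>f\<in>F. matching_sum (E f) (h f) y) = (\<Sum>d\<in>?P h. \<Prod>f\<in>F. \<Prod>e\<in>d f. y e)"
      unfolding matching_sum_def
      by (rule prod_sum_PiE) (use F E in \<open>auto intro: finite_perfect_matchings\<close>)
  qed
  also have "\<dots> = (\<Sum>(h, d)\<in>Sigma ?H ?P. \<Prod>f\<in>F. \<Prod>e\<in>d f. y e)"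
    using F E finH by (intro sum.Sigma) (auto intro!: finite_PiE finite_perfect_matchings)
  also have "\<dots> = (\<Sum>M\<in>perfect_matchings (\<Union>f\<in>F. E f) V. \<Prod>e\<in>M. y e)"
  \<comment> \<open>The functions are restricted to \<open>F\<close> because \<open>PiE\<close>
    contains extensional functions only.\<close>
  proof (rule sum.reindex_bij_witness[where
        i = "\<lambda>M. (\<lambda>f\<in>F. ?I (M \<inter> E f), \<lambda>f\<in>F. M \<inter> E f)" and j = "\<lambda>(h, d). \<Union>f\<in>F. d f"], goal_cases)
    case (1 a)
    obtain h d where a: "a = (h, d)" by (cases a)
    have h: "h \<in> ?H" and d: "d \<in> ?P h" using 1 a by auto
    have dE: "d f \<in> perfect_matchings (E f) (h f)" if "f \<in> F" for f
      using d that by auto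
    have eq: "(\<Union>f\<in>F. d f) \<inter> E f = d f" if "f \<in> F" for f
    proof (intro equalityI subsetI)
      fix e assume "e \<in> (\<Union>f\<in>F. d f) \<inter> E f"
      then obtain f' where f': "f' \<in> F" "e \<in> d f'" "e \<in> E f" by blast
      then have "f' = f" using perfect_matchingsD(1)[OF dE] E_unique that by blast
      then show "e \<in> d f" using f' by simp
    next
      fix e assume "e \<in> d f"
      then show "e \<in> (\<Union>f\<in>F. d f) \<inter> E f"
        using perfect_matchingsD(1)[OF dE] that by blast
    qed
    have eq': "?I (d f) = h f" if "f \<in> F" for f
      using perfect_matchingsD(2,3)[OF dE[OF that]] by blast
    have "(\<lambda>f\<in>F. (\<Union>f\<in>F. d f) \<inter> E f) = (\<lambda>f\<in>F. d f)"
      using eq by (intro restrict_ext) simp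
    also have "\<dots> = d"
      using d by (simp add: PiE_def extensional_restrict)
    finally have 1: "(\<lambda>f\<in>F. (\<Union>f\<in>F. d f) \<inter> E f) = d" .
    have "(\<lambda>f\<in>F. ?I ((\<Union>f\<in>F. d f) \<inter> E f)) = (\<lambda>f\<in>F. h f)"
      using eq eq' by (intro restrict_ext) simp
    also have "\<dots> = h"
      using h by (simp add: PiE_def extensional_restrict)
    finally show ?case unfolding a using 1 by simp
  next
    case (2 a)
    obtain h d where a: "a = (h, d)" by (cases a)
    have h: "h \<in> ?H" and d: "d \<in> ?P h" using 2 a by auto
    have D: "d f \<in> perfect_matchings (E f) (h f)" if "f \<in> F" for f
      using d that by auto
    note D = perfect_matchingsD[OF D]
    have h_ex: "\<exists>f\<in>F. v \<in> h f" if "v \<in> V" for v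
      using h that by blast
    have h_uniq: "f = f'" if "f \<in> F" "f' \<in> F" "v \<in> h f" "v \<in> h f'" for v f f'
      using h that by blast
    have "(\<Union>f\<in>F. d f) \<in> perfect_matchings (\<Union>f\<in>F. E f) V"
    proof (rule perfect_matchingsI)
      show "(\<Union>f\<in>F. d f) \<subseteq> (\<Union>f\<in>F. E f)" using D(1) by blast
    next
      fix e assume "e \<in> (\<Union>f\<in>F. d f)"
      then show "ends e \<subseteq> V" using D(2) h by blast
    next
      fix v assume "v \<in> V"
      then obtain f where "f \<in> F" "v \<in> h f" using h_ex by blast
      then show "\<exists>e\<in>(\<Union>f\<in>F. d f). v \<in> ends e" using D(3)[of f v] by blast
    next
      fix v e e' assume *: "e \<in> (\<Union>f\<in>F. d f)" "e' \<in> (\<Union>f\<in>F. d f)" "v \<in> ends e" "v \<in> ends e'"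
      then obtain f f' where f: "f \<in> F" "f' \<in> F" "e \<in> d f" "e' \<in> d f'" by blast
      then have "f = f'" using D(2)[of f e] D(2)[of f' e'] * h_uniq by blast
      then show "e = e'" using D(4)[of f e e' v] f * by blast
    qed
    then show ?case by (simp add: a)
  next
    case (3 M)
    then show ?case using perfect_matchingsD(1)[OF 3] by auto
  next
    case (4 M)
    note D = perfect_matchingsD[OF 4]
    have "\<exists>!f. f \<in> F \<and> v \<in> ?I (M \<inter> E f)" if v: "v \<in> V" for v
    proof -
      obtain e where e: "e \<in> M" "v \<in> ends e" using D(3)[OF v] by blast
      obtain f where f: "f \<in> F" "e \<in> E f" using D(1) e by blast
      show ?thesis
      proof (rule ex1I[of _ f])
        show "f \<in> F \<and> v \<in> ?I (M \<inter> E f)" using f e by blast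
        fix f' assume f': "f' \<in> F \<and> v \<in> ?I (M \<inter> E f')"
        then obtain e' where "e' \<in> M" "e' \<in> E f'" "v \<in> ends e'" by blast
        then show "f' = f" using D(4)[of e e' v] e f f' E_unique by blast
      qed
    qed
    moreover have "M \<inter> E f \<in> perfect_matchings (E f) (?I (M \<inter> E f))" if "f \<in> F" for f
      by (rule perfect_matchingsI) (use D(4) in blast)+
    moreover have "?I (M \<inter> E f) \<subseteq> C f" "?I (M \<inter> E f) \<subseteq> V" if "f \<in> F" for f
      using ends[OF that] D(2) by blast+
    ultimately show ?case by (simp add: PiE_def Pi_def cong: conj_cong)
  next
    case (5 a)
    obtain h d where a: "a = (h, d)" by (cases a)
    have D: "d f \<in> perfect_matchings (E f) (h f)" if "f \<in> F" for f
      using 5 a that by auto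
    have dE: "d f \<subseteq> E f" if "f \<in> F" for f
      using perfect_matchingsD(1)[OF D] that by blast
    have "(\<Prod>e\<in>(\<Union>f\<in>F. d f). y e) = (\<Prod>f\<in>F. \<Prod>e\<in>d f. y e)"
    proof (rule prod.UNION_disjoint[OF F])
      show "\<forall>f\<in>F. finite (d f)" using dE E by (meson finite_subset)
      show "\<forall>f\<in>F. \<forall>f'\<in>F. f \<noteq> f' \<longrightarrow> d f \<inter> d f' = {}"
        using dE E_unique by blast
    qed
    then show ?case by (simp add: a)
  qed
  finally show ?thesis by (simp add: matching_sum_def)
qed


subsection \<open>The four-cycle\<close>

definition square :: "'a \<Rightarrow> 'a \<Rightarrow> 'a \<Rightarrow> 'a \<Rightarrow> ('a \<times> 'a) set" where
  "square a b c d = {(a, b), (b, a), (b, c), (c, b), (c, d), (d, c), (d, a), (a, d)}"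

text \<open>A dimer on an undirected edge may point either way. For a skew sign this sum is the sign
  times the difference of the weights of the two adjacent faces.\<close>

definition sym_weight :: "('a \<times> 'a \<Rightarrow> 'b :: ab_semigroup_add) \<Rightarrow> 'a \<Rightarrow> 'a \<Rightarrow> 'b" where
  "sym_weight y u v = y (u, v) + y (v, u)"

lemma square_rotate: "square b c d a = square a b c d"
  by (auto simp: square_def)

lemma matching_sum_square_step:
  assumes "distinct [a, b, c, d]" and "a \<in> V"
  shows "matching_sum (square a b c d) V y =
    (if b \<in> V then sym_weight y a b * matching_sum (square a b c d) (V - {a, b}) y else 0) +
    (if d \<in> V then sym_weight y d a * matching_sum (square a b c d) (V - {a, d}) y else 0)"
proof -
  have "{e \<in> square a b c d. a \<in> ends e \<and> ends e \<subseteq> V} =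
      (if b \<in> V then {(a, b), (b, a)} else {}) \<union> (if d \<in> V then {(d, a), (a, d)} else {})"
    using assms by (auto simp: square_def)
  moreover have "finite (square a b c d)"
    by (simp add: square_def)
  ultimately show ?thesis
    using assms
    by (subst matching_sum_step[of _ a])
       (auto simp: sym_weight_def algebra_simps insert_commute)
qed

text \<open>Only the empty set, the four edges and the full set of corners can be matched; every
  value follows by expansion at a corner.\<close>

lemma matching_sum_square_values:
  fixes y :: "'a \<times> 'a \<Rightarrow> 'b :: comm_ring_1"
  assumes "distinct [a, b, c, d]"
  defines "m \<equiv> \<lambda>S. matching_sum (square a b c d) S y" and "x \<equiv> sym_weight y"
  shows "m {} = 1" "m {a} = 0" "m {b} = 0" "m {c} = 0" "m {d} = 0"
    "m {a, b} = x a b" "m {b, c} = x b c" "m {c, d} = x c d" "m {a, d} = x d a"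
    "m {a, c} = 0" "m {b, d} = 0"
    "m {a, b, c} = 0" "m {a, b, d} = 0" "m {a, c, d} = 0" "m {b, c, d} = 0"
    "m {a, b, c, d} = x a b * x c d + x b c * x d a"
proof -
  have step: "m V = (if q \<in> V then x p q * m (V - {p, q}) else 0) +
      (if s \<in> V then x s p * m (V - {p, s}) else 0)"
    if "distinct [p, q, r, s]" "square p q r s = square a b c d" "p \<in> V" for p q r s V
    using matching_sum_square_step[OF that(1,3), of y] by (simp add: that(2) m_def x_def)
  \<comment> \<open>Rotating the cycle leaves \<open>square\<close> unchanged, so the expansion at
    the first corner serves at all four.\<close>
  note rot = square_rotate[of a b c d] square_rotate[of b c d a] square_rotate[of c d a b]
  have A: "m V = (if b \<in> V then x a b * m (V - {a, b}) else 0) +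
      (if d \<in> V then x d a * m (V - {a, d}) else 0)" if "a \<in> V" for V
    using assms(1) that by (intro step) auto
  have B: "m V = (if c \<in> V then x b c * m (V - {b, c}) else 0) +
      (if a \<in> V then x a b * m (V - {b, a}) else 0)" if "b \<in> V" for V
    using assms(1) that rot by (intro step[of _ _ d]) auto
  have C: "m V = (if d \<in> V then x c d * m (V - {c, d}) else 0) +
      (if b \<in> V then x b c * m (V - {c, b}) else 0)" if "c \<in> V" for V
    using assms(1) that rot by (intro step[of _ _ a]) auto
  have D: "m V = (if a \<in> V then x d a * m (V - {d, a}) else 0) +
      (if c \<in> V then x c d * m (V - {d, c}) else 0)" if "d \<in> V" for V
    using assms(1) that rot by (intro step[of _ _ b]) auto
  show empty: "m {} = 1" by (simp add: m_def matching_sum_empty)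
  show ab: "m {a} = 0" "m {a, b} = x a b" "m {a, c} = 0" "m {a, d} = x d a"
    using A[of "{a}"] A[of "{a, b}"] A[of "{a, c}"] A[of "{a, d}"] assms(1) empty
    by auto
  show b: "m {b} = 0" "m {b, c} = x b c" "m {b, d} = 0"
    using B[of "{b}"] B[of "{b, c}"] B[of "{b, d}"] assms(1) empty by auto
  show c: "m {c} = 0" "m {c, d} = x c d" "m {d} = 0"
    using C[of "{c}"] C[of "{c, d}"] D[of "{d}"] assms(1) empty by auto
  have del: "{a, b, c} - {a, b} = {c}" "{a, b, d} - {a, b} = {d}" "{a, b, d} - {a, d} = {b}"
    "{a, c, d} - {a, d} = {c}" "{b, c, d} - {b, c} = {d}"
    "{a, b, c, d} - {a, b} = {c, d}" "{a, b, c, d} - {a, d} = {b, c}"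
    using assms(1) by auto
  show "m {a, b, c} = 0" "m {a, b, d} = 0" "m {a, c, d} = 0"
    using A[of "{a, b, c}"] A[of "{a, b, d}"] A[of "{a, c, d}"] assms(1) b c del by auto
  show "m {b, c, d} = 0"
    using B[of "{b, c, d}"] assms(1) b c del by auto
  show "m {a, b, c, d} = x a b * x c d + x b c * x d a"
    using A[of "{a, b, c, d}"] assms(1) b c del by (auto simp: algebra_simps)
qed

text \<open>An edge and the opposite edge are complementary sets of corners, so y' must be the
  opposite weight divided by \<open>\<Delta>\<close>. The exchange of the empty and the full set is
  then automatic, as the full sum for y' becomes \<open>1 / \<Delta>\<close>. All other sets vanish
  together with their complements.\<close>

lemma matching_sum_square_complement:
  fixes y y' :: "'a \<times> 'a \<Rightarrow> 'b :: field"
  assumes dist: "distinct [a, b, c, d]"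
    and \<Delta>: "\<Delta> = sym_weight y a b * sym_weight y c d + sym_weight y b c * sym_weight y d a" "\<Delta> \<noteq> 0"
    and y': "sym_weight y' a b * \<Delta> = sym_weight y c d" "sym_weight y' c d * \<Delta> = sym_weight y a b"
      "sym_weight y' b c * \<Delta> = sym_weight y d a" "sym_weight y' d a * \<Delta> = sym_weight y b c"
    and S: "S \<subseteq> {a, b, c, d}"
  shows "matching_sum (square a b c d) S y =
    \<Delta> * matching_sum (square a b c d) ({a, b, c, d} - S) y'"
proof -
  note vals = matching_sum_square_values[OF dist]
  have "\<Delta> * (sym_weight y' a b * sym_weight y' c d + sym_weight y' b c * sym_weight y' d a) * \<Delta> =
      (sym_weight y' a b * \<Delta>) * (sym_weight y' c d * \<Delta>) +
      (sym_weight y' b c * \<Delta>) * (sym_weight y' d a * \<Delta>)"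
    by (simp add: algebra_simps)
  also have "\<dots> = 1 * \<Delta>"
    unfolding y' by (simp add: \<Delta>(1) algebra_simps)
  finally have full: "\<Delta> * (sym_weight y' a b * sym_weight y' c d + sym_weight y' b c * sym_weight y' d a) = 1"
    using \<Delta>(2) by simp
  have del: "{a, b, c, d} - {a} = {b, c, d}" "{a, b, c, d} - {b} = {a, c, d}"
    "{a, b, c, d} - {c} = {a, b, d}" "{a, b, c, d} - {d} = {a, b, c}"
    "{a, b, c, d} - {a, b} = {c, d}" "{a, b, c, d} - {a, c} = {b, d}" "{a, b, c, d} - {a, d} = {b, c}"
    "{a, b, c, d} - {b, c} = {a, d}" "{a, b, c, d} - {b, d} = {a, c}" "{a, b, c, d} - {c, d} = {a, b}"
    "{a, b, c, d} - {a, b, c} = {d}" "{a, b, c, d} - {a, b, d} = {c}" "{a, b, c, d} - {a, c, d} = {b}"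
    "{a, b, c, d} - {b, c, d} = {a}" "{a, b, c, d} - {a, b, c, d} = {}"
    using dist by auto
  have "S \<in> Pow {a, b, c, d}" using S by blast
  then have "S \<in> {{}, {a}, {b}, {c}, {d}, {a, b}, {a, c}, {a, d}, {b, c}, {b, d}, {c, d},
      {a, b, c}, {a, b, d}, {a, c, d}, {b, c, d}, {a, b, c, d}}"
    by (simp only: Pow_insert Pow_empty image_insert image_empty Un_insert_left Un_insert_right Un_empty_left)
       (auto simp: insert_commute)
  then show ?thesis
    using y' full \<Delta>(1)
    by (elim insertE emptyE)
       (simp_all only: del vals Diff_empty mult_zero_right mult_1_right, simp_all add: mult.commute)
qed


subsection \<open>Faces and vertices of the Aztec diamond\<close>

text \<open>The faces that evolve at time \<open>s\<close>. Under the parity hypothesis on the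
  centre that recurs below, they include all faces at distance k in the diamond of size
  \<open>Suc k\<close>, while its open faces have the other parity.\<close>

definition core_faces :: "int \<Rightarrow> nat \<Rightarrow> face \<Rightarrow> face set" where
  "core_faces s k c = {f \<in> internal_faces k c. even (fst f + snd f + s)}"

lemma boundary_square: "boundary (i, j) = square (i, j) (i - 1, j) (i - 1, j - 1) (i, j - 1)"
proof (intro equalityI subsetI)
  fix e assume e: "e \<in> boundary (i, j)"
  obtain p q r t where pq: "e = ((p, q), (r, t))" by (cases e) auto
  have "p = i \<or> p = i - 1" "q = j \<or> q = j - 1" "r = i \<or> r = i - 1" "t = j \<or> t = j - 1"
    and "\<bar>p - r\<bar> + \<bar>q - t\<bar> = 1"
    using e by (auto simp: boundary_def pq)
  then show "e \<in> square (i, j) (i - 1, j) (i - 1, j - 1) (i, j - 1)"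
    by (elim disjE) (simp_all add: square_def pq)
next
  fix e assume "e \<in> square (i, j) (i - 1, j) (i - 1, j - 1) (i, j - 1)"
  then show "e \<in> boundary (i, j)"
    unfolding square_def by (elim insertE emptyE) (simp_all add: boundary_def)
qed

lemma corners_square: "corners (i, j) = {(i, j), (i - 1, j), (i - 1, j - 1), (i, j - 1)}"
  by auto

lemma mem_corners: "(p, q) \<in> corners (i, j) \<longleftrightarrow> (i = p \<or> i = p + 1) \<and> (j = q \<or> j = q + 1)"
  by auto

lemma finite_boundary: "finite (boundary f)"
  by (cases f) (simp add: boundary_square square_def)

lemma finite_corners: "finite (corners f)"
  by (cases f) simp

lemma ends_boundary: "e \<in> boundary f \<Longrightarrow> ends e \<subseteq> corners f"
  by (auto simp: boundary_def)

lemma abs_succ: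
  fixes X :: int
  shows "\<bar>X + 1\<bar> = \<bar>X\<bar> + 1 \<or> \<bar>X + 1\<bar> = \<bar>X\<bar> - 1" and "\<bar>2 * X + 1\<bar> = \<bar>X\<bar> + \<bar>X + 1\<bar>"
  by arith+

text \<open>The vertex lies at (p + 1/2, q + 1/2), so this bounds its l1-distance from the centre by
  k; doubling keeps all numbers integral.\<close>

lemma mem_aztec_vertices:
  "(p, q) \<in> aztec_vertices k (u, v) \<longleftrightarrow> \<bar>2 * p + 1 - 2 * u\<bar> + \<bar>2 * q + 1 - 2 * v\<bar> \<le> 2 * int k"
proof -
  have "(p, q) \<in> aztec_vertices k (u, v) \<longleftrightarrow>
      (\<exists>i j. (i = p \<or> i = p + 1) \<and> (j = q \<or> j = q + 1) \<and> \<bar>i - u\<bar> + \<bar>j - v\<bar> < int k)"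
    unfolding aztec_vertices_def internal_faces_def
    by (simp only: UN_iff bex_simps mem_Collect_eq split_paired_Ex mem_corners Bex_def fdist.simps) blast
  also have "\<dots> \<longleftrightarrow> \<bar>p - u\<bar> + \<bar>q - v\<bar> < int k \<or> \<bar>p + 1 - u\<bar> + \<bar>q - v\<bar> < int k \<or>
      \<bar>p - u\<bar> + \<bar>q + 1 - v\<bar> < int k \<or> \<bar>p + 1 - u\<bar> + \<bar>q + 1 - v\<bar> < int k"
    by blast
  also have "\<dots> \<longleftrightarrow> \<bar>2 * (p - u) + 1\<bar> + \<bar>2 * (q - v) + 1\<bar> \<le> 2 * int k"
    unfolding abs_succ(2) using abs_succ(1)[of "p - u"] abs_succ(1)[of "q - v"]
    by (simp only: add_diff_eq diff_add_eq) linarith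
  finally show ?thesis by (simp add: algebra_simps)
qed

lemma mem_internal_faces: "(i, j) \<in> internal_faces k (u, v) \<longleftrightarrow> \<bar>i - u\<bar> + \<bar>j - v\<bar> < int k"
  by (simp add: internal_faces_def)

lemma mem_all_faces: "(i, j) \<in> all_faces k (u, v) \<longleftrightarrow> \<bar>i - u\<bar> + \<bar>j - v\<bar> \<le> int k"
  by (auto simp: all_faces_def internal_faces_def open_faces_def)

lemma mem_core_faces:
  "(i, j) \<in> core_faces s k (u, v) \<longleftrightarrow> \<bar>i - u\<bar> + \<bar>j - v\<bar> < int k \<and> even (i + j + s)"
  by (simp add: core_faces_def internal_faces_def)

lemma finite_internal_faces: "finite (internal_faces k c)"
  using finite_all_faces by (rule finite_subset[rotated]) (auto simp: all_faces_def)

lemma finite_core_faces: "finite (core_faces s k c)"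
  using finite_internal_faces by (rule finite_subset[rotated]) (auto simp: core_faces_def)

lemma finite_aztec_vertices: "finite (aztec_vertices k c)"
  unfolding aztec_vertices_def by (auto simp: finite_internal_faces finite_corners)

text \<open>The four faces at a vertex form two diagonal pairs of opposite parity; \<open>s\<close>
  gives the evolving pair and \<open>s + 1\<close> the other one.\<close>

fun vertex_faces :: "int \<Rightarrow> vertex \<Rightarrow> face set" where
  "vertex_faces s (p, q) = (if even (p + q + s) then {(p, q), (p + 1, q + 1)} else {(p + 1, q), (p, q + 1)})"

lemma vertex_faces_iff:
  "f \<in> vertex_faces s v \<longleftrightarrow> v \<in> corners f \<and> even (fst f + snd f + s)"
proof -
  obtain i j p q where [simp]: "f = (i, j)" "v = (p, q)" by (cases f; cases v)
  show ?thesis by (auto simp: mem_corners simp del: corners.simps)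
qed

text \<open>The doubled distance of a vertex is the sum of the distances of its two evolving faces.
  These have the parity of k and differ by 0 or 2. Hence the sum is at most 2 k + 2 exactly when one
  of them is at most k, and at most 2 k exactly when both are.\<close>

lemma aztec_vertices_core:
  assumes "even (fst c + snd c + s + int k)"
  shows "v \<in> aztec_vertices (Suc k) c \<longleftrightarrow> vertex_faces s v \<inter> core_faces s (Suc k) c \<noteq> {}" (is ?A)
    and "v \<in> aztec_vertices k c \<longleftrightarrow> vertex_faces s v \<subseteq> core_faces s (Suc k) c" (is ?B)
proof -
  obtain x y p q where [simp]: "c = (x, y)" "v = (p, q)" by (cases c; cases v)
  have two: "(X + Y \<le> 2 * int k + 2 \<longleftrightarrow> X < int k + 1 \<or> Y < int k + 1) \<and>
      (X + Y \<le> 2 * int k \<longleftrightarrow> X < int k + 1 \<and> Y < int k + 1)"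
    if "even (X + int k)" "X = Y \<or> X = Y + 2 \<or> Y = X + 2" for X Y
    using that by presburger
  define a a' b b' where "a = \<bar>p - x\<bar>" and "a' = \<bar>p + 1 - x\<bar>" and "b = \<bar>q - y\<bar>" and "b' = \<bar>q + 1 - y\<bar>"
  note defs = a_def a'_def b_def b'_def
  have dist: "\<bar>2 * p + 1 - 2 * x\<bar> = a + a'" "\<bar>2 * q + 1 - 2 * y\<bar> = b + b'"
    using abs_succ(2)[of "p - x"] abs_succ(2)[of "q - y"] by (simp_all add: algebra_simps defs)
  have step: "a' = a + 1 \<or> a' = a - 1" "b' = b + 1 \<or> b' = b - 1"
    unfolding defs by arith+
  have par: "even a \<longleftrightarrow> even (p - x)" "even a' \<longleftrightarrow> even (p + 1 - x)"
    "even b \<longleftrightarrow> even (q - y)" "even b' \<longleftrightarrow> even (q + 1 - y)"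
    by (simp_all add: defs)
  have core: "(p, q) \<in> core_faces s (Suc k) c \<longleftrightarrow> a + b < int k + 1 \<and> even (p + q + s)"
    "(p + 1, q + 1) \<in> core_faces s (Suc k) c \<longleftrightarrow> a' + b' < int k + 1 \<and> even (p + q + s)"
    "(p + 1, q) \<in> core_faces s (Suc k) c \<longleftrightarrow> a' + b < int k + 1 \<and> odd (p + q + s)"
    "(p, q + 1) \<in> core_faces s (Suc k) c \<longleftrightarrow> a + b' < int k + 1 \<and> odd (p + q + s)"
    unfolding \<open>c = (x, y)\<close> mem_core_faces defs by (auto simp: add.commute)
  have vert: "v \<in> aztec_vertices (Suc k) c \<longleftrightarrow> a + a' + (b + b') \<le> 2 * int k + 2"
    "v \<in> aztec_vertices k c \<longleftrightarrow> a + a' + (b + b') \<le> 2 * int k"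
    unfolding \<open>c = (x, y)\<close> \<open>v = (p, q)\<close> mem_aztec_vertices dist by auto
  have "?A \<and> ?B"
  proof (cases "even (p + q + s)")
    case True
    then have "even (a + b + int k)"
      using assms par(1,3) by simp blast
    then have "(a + b + (a' + b') \<le> 2 * int k + 2 \<longleftrightarrow> a + b < int k + 1 \<or> a' + b' < int k + 1) \<and>
      (a + b + (a' + b') \<le> 2 * int k \<longleftrightarrow> a + b < int k + 1 \<and> a' + b' < int k + 1)"
      by (rule two) (use step in linarith)
    moreover have "a + b + (a' + b') = a + a' + (b + b')" by simp
    ultimately show ?thesis
      unfolding vert using True core(1,2) by simp
  next
    case False
    then have "even (a' + b + int k)"
      using assms par(2,3) by simp blast
    then have "(a' + b + (a + b') \<le> 2 * int k + 2 \<longleftrightarrow> a' + b < int k + 1 \<or> a + b' < int k + 1) \<and>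
      (a' + b + (a + b') \<le> 2 * int k \<longleftrightarrow> a' + b < int k + 1 \<and> a + b' < int k + 1)"
      by (rule two) (use step in linarith)
    moreover have "a' + b + (a + b') = a + a' + (b + b')" by simp
    ultimately show ?thesis
      unfolding vert using False core(3,4) by simp
  qed
  then show ?A ?B by blast+
qed

lemma aztec_darts_restrict:
  assumes e: "e \<in> aztec_darts (Suc k) c" "ends e \<subseteq> aztec_vertices k c"
  shows "e \<in> aztec_darts k c"
proof -
  obtain x y where c: "c = (x, y)" by (cases c)
  obtain p q r t where pq: "e = ((p, q), (r, t))" by (cases e) auto
  have adj: "adjacent (p, q) (r, t)"
    using e(1) by (auto simp: aztec_darts_def boundary_def pq)
  have d: "\<bar>2 * p + 1 - 2 * x\<bar> + \<bar>2 * q + 1 - 2 * y\<bar> \<le> 2 * int k"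
    "\<bar>2 * r + 1 - 2 * x\<bar> + \<bar>2 * t + 1 - 2 * y\<bar> \<le> 2 * int k"
    using e(2) by (simp_all add: mem_aztec_vertices pq c)
  have "\<exists>i j. e \<in> boundary (i, j) \<and> \<bar>i - x\<bar> + \<bar>j - y\<bar> < int k"
  proof -
    consider "r = p + 1" "t = q" | "r = p - 1" "t = q" | "r = p" "t = q + 1" | "r = p" "t = q - 1"
      using adj by simp arith
    then show ?thesis
    proof cases
      case 1
      then have "e \<in> boundary (r, q)" "e \<in> boundary (r, q + 1)"
        by (auto simp: boundary_square square_def pq)
      moreover have "\<bar>r - x\<bar> + \<bar>q - y\<bar> < int k \<or> \<bar>r - x\<bar> + \<bar>q + 1 - y\<bar> < int k"
        using d 1 by linarith
      ultimately show ?thesis by blast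
    next
      case 2
      then have "e \<in> boundary (p, q)" "e \<in> boundary (p, q + 1)"
        by (auto simp: boundary_square square_def pq)
      moreover have "\<bar>p - x\<bar> + \<bar>q - y\<bar> < int k \<or> \<bar>p - x\<bar> + \<bar>q + 1 - y\<bar> < int k"
        using d 2 by linarith
      ultimately show ?thesis by blast
    next
      case 3
      then have "e \<in> boundary (p, t)" "e \<in> boundary (p + 1, t)"
        by (auto simp: boundary_square square_def pq)
      moreover have "\<bar>p - x\<bar> + \<bar>t - y\<bar> < int k \<or> \<bar>p + 1 - x\<bar> + \<bar>t - y\<bar> < int k"
        using d 3 by linarith
      ultimately show ?thesis by blast
    next
      case 4
      then have "e \<in> boundary (p, q)" "e \<in> boundary (p + 1, q)"
        by (auto simp: boundary_square square_def pq)
      moreover have "\<bar>p - x\<bar> + \<bar>q - y\<bar> < int k \<or> \<bar>p + 1 - x\<bar> + \<bar>q - y\<bar> < int k"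
        using d 4 by linarith
      ultimately show ?thesis by blast
    qed
  qed
  then show ?thesis
    unfolding aztec_darts_def c by (fastforce simp: mem_internal_faces)
qed

text \<open>The two faces beside an edge have opposite parities.\<close>

lemma boundary_unique:
  assumes "e \<in> boundary f" "e \<in> boundary f'" "even (fst f + snd f + s)" "even (fst f' + snd f' + s)"
  shows "f = f'"
proof -
  obtain p q r t where e: "e = ((p, q), (r, t))"
    by (cases e) auto
  have "f \<in> vertex_faces s (p, q)" "f \<in> vertex_faces s (r, t)"
    "f' \<in> vertex_faces s (p, q)" "f' \<in> vertex_faces s (r, t)"
    using assms unfolding vertex_faces_iff boundary_def e by auto
  moreover have "r = p + 1 \<and> t = q \<or> r = p - 1 \<and> t = q \<or> r = p \<and> t = q + 1 \<or> r = p \<and> t = q - 1"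
    using assms(1) unfolding boundary_def e by simp arith
  ultimately show ?thesis
    by (elim disjE) (auto split: if_splits)
qed

lemma aztec_darts_core:
  assumes "even (fst c + snd c + s + int k)"
  shows "aztec_darts (Suc k) c = (\<Union>f\<in>core_faces s (Suc k) c. boundary f)"
proof (intro equalityI subsetI)
  fix e assume "e \<in> aztec_darts (Suc k) c"
  then obtain f where f: "f \<in> internal_faces (Suc k) c" "e \<in> boundary f"
    by (auto simp: aztec_darts_def)
  show "e \<in> (\<Union>f\<in>core_faces s (Suc k) c. boundary f)"
  proof (cases "even (fst f + snd f + s)")
    case True
    then have "f \<in> core_faces s (Suc k) c" using f(1) by (simp add: core_faces_def)
    then show ?thesis using f(2) by blast
  next
    case False
    obtain i j where ij: "f = (i, j)" by (cases f)
    obtain x y where c: "c = (x, y)" by (cases c)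
    have "e \<in> boundary (i + 1, j) \<or> e \<in> boundary (i - 1, j) \<or> e \<in> boundary (i, j + 1) \<or> e \<in> boundary (i, j - 1)"
      using f(2) by (auto simp: boundary_square square_def ij)
    \<comment> \<open>Parity excludes distance k, so the face lies deep enough for all four
      neighbours to be core faces.\<close>
    moreover have "\<bar>i - x\<bar> + \<bar>j - y\<bar> < int k"
    proof -
      have "odd (i - x + (j - y) + int k)"
        using False assms unfolding ij c by simp presburger
      then have "odd (\<bar>i - x\<bar> + \<bar>j - y\<bar> + int k)"
        by simp
      moreover have "X \<noteq> Y" if "odd (X + Y)" for X Y :: int
        using that by auto
      ultimately have "\<bar>i - x\<bar> + \<bar>j - y\<bar> \<noteq> int k" by blast
      then show ?thesis using f(1) by (simp add: mem_internal_faces ij c)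
    qed
    ultimately show ?thesis
      using False by (elim disjE) (force simp: mem_core_faces ij c)+
  qed
next
  fix e assume "e \<in> (\<Union>f\<in>core_faces s (Suc k) c. boundary f)"
  then show "e \<in> aztec_darts (Suc k) c" by (auto simp: core_faces_def aztec_darts_def)
qed


subsection \<open>Urban renewal\<close>

lemma internal_faces_Suc: "internal_faces k c \<subseteq> internal_faces (Suc k) c"
  by (auto simp: internal_faces_def)

lemma aztec_matching_sum:
  assumes "even (fst c + snd c + s + int k)"
  shows "matching_sum (aztec_darts (Suc k) c) V y =
    (\<Sum>h\<in>{h\<in>PiE (core_faces s (Suc k) c) (\<lambda>f. Pow (corners f)).
        (\<forall>f\<in>core_faces s (Suc k) c. h f \<subseteq> V) \<and>
        (\<forall>v\<in>V. \<exists>!f. f \<in> core_faces s (Suc k) c \<and> v \<in> h f)}.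
       \<Prod>f\<in>core_faces s (Suc k) c. matching_sum (boundary f) (h f) y)"
  unfolding aztec_darts_core[OF assms]
proof (rule matching_sum_UN)
  show "disjoint_family_on boundary (core_faces s (Suc k) c)"
    unfolding disjoint_family_on_def core_faces_def using boundary_unique by blast
qed (simp_all only: finite_core_faces finite_boundary finite_corners ends_boundary)

lemma vertex_faces_two:
  obtains f g where "vertex_faces s v = {f, g}" "f \<noteq> g"
proof -
  obtain p q where v: "v = (p, q)" by (cases v)
  show thesis
  proof (cases "even (p + q + s)")
    case True
    show thesis by (rule that[of "(p, q)" "(p + 1, q + 1)"]) (use True v in simp_all)
  next
    case False
    show thesis by (rule that[of "(p + 1, q)" "(p, q + 1)"]) (use False v in simp_all)
  qed
qed

text \<open>Each vertex of the large diamond is covered through exactly one of its core faces. After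
  complementing on every four-cycle, a vertex with two core faces is again covered through exactly
  one, and a vertex with a single core face through none. By \<open>aztec_vertices_core\<close>
  these are the vertices inside and outside the small diamond.\<close>

lemma urban_renewal:
  assumes par: "even (fst c + snd c + s + int k)"
    and y': "\<And>f S. f \<in> core_faces s (Suc k) c \<Longrightarrow> S \<subseteq> corners f \<Longrightarrow>
      matching_sum (boundary f) S y = \<Delta> f * matching_sum (boundary f) (corners f - S) y'"
  shows "matching_sum (aztec_darts (Suc k) c) (aztec_vertices (Suc k) c) y =
    (\<Prod>f\<in>core_faces s (Suc k) c. \<Delta> f) * matching_sum (aztec_darts k c) (aztec_vertices k c) y'"
proof -
  let ?F = "core_faces s (Suc k) c" and ?V' = "aztec_vertices (Suc k) c" and ?V = "aztec_vertices k c"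
  define H where "H V = {h\<in>PiE ?F (\<lambda>f. Pow (corners f)). (\<forall>f\<in>?F. h f \<subseteq> V) \<and>
      (\<forall>v\<in>V. \<exists>!f. f \<in> ?F \<and> v \<in> h f)}" for V
  define co where "co h = (\<lambda>f\<in>?F. corners f - h f)" for h :: "face \<Rightarrow> vertex set"
  note core = aztec_vertices_core[OF par]
  have vf: "f \<in> ?F \<Longrightarrow> v \<in> corners f \<longleftrightarrow> f \<in> vertex_faces s v" for f v
    unfolding vertex_faces_iff by (simp add: core_faces_def del: corners.simps)
  have co_co: "co (co h) = h" if "h \<in> PiE ?F (\<lambda>f. Pow (corners f))" for h
  proof
    fix f
    show "co (co h) f = h f"
    proof (cases "f \<in> ?F")
      case True
      then have "h f \<subseteq> corners f" using PiE_mem[OF that True] by (simp only: Pow_iff)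
      then show ?thesis using True by (simp add: co_def double_diff del: corners.simps)
    next
      case False
      then show ?thesis using PiE_arb[OF that] by (simp add: co_def)
    qed
  qed
  have co_PiE: "co h \<in> PiE ?F (\<lambda>f. Pow (corners f))" for h
    unfolding co_def by (rule restrict_PiE_iff[THEN iffD2]) blast
  have H_co: "h \<in> H ?V' \<longleftrightarrow> co h \<in> H ?V" if h: "h \<in> PiE ?F (\<lambda>f. Pow (corners f))" for h
  proof -
    have sub: "h f \<subseteq> corners f" if "f \<in> ?F" for f
      using PiE_mem[OF h that] by (simp only: Pow_iff)
    \<comment> \<open>Decided vertex by vertex, according to which of its two faces of core parity
      belong to the diamond.\<close>
    have *: "(v \<in> ?V' \<longrightarrow> (\<exists>!f. f \<in> ?F \<and> v \<in> h f)) \<longleftrightarrow>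
        ((\<forall>f\<in>?F. v \<in> co h f \<longrightarrow> v \<in> ?V) \<and> (v \<in> ?V \<longrightarrow> (\<exists>!f. f \<in> ?F \<and> v \<in> co h f)))" for v
    proof -
      obtain f g where fg: "vertex_faces s v = {f, g}" "f \<noteq> g" by (rule vertex_faces_two)
      have in_h: "f' \<in> ?F \<and> v \<in> h f' \<longleftrightarrow> f' \<in> {f, g} \<inter> ?F \<and> v \<in> h f'" for f'
        using vf[of f' v] sub[of f'] fg by blast
      have in_co: "f' \<in> ?F \<and> v \<in> co h f' \<longleftrightarrow> f' \<in> {f, g} \<inter> ?F \<and> v \<notin> h f'" for f'
        using vf[of f' v] fg unfolding co_def by (cases "f' \<in> ?F") (simp_all del: corners.simps)
      have in_co': "(\<forall>f'\<in>?F. v \<in> co h f' \<longrightarrow> v \<in> ?V) \<longleftrightarrow> 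
          (\<forall>f'. f' \<in> {f, g} \<inter> ?F \<and> v \<notin> h f' \<longrightarrow> v \<in> ?V)"
        using in_co by blast
      show ?thesis
        unfolding in_co' in_h in_co unfolding core fg using fg(2) by (cases "f \<in> ?F"; cases "g \<in> ?F") auto
    qed
    have "h \<in> H ?V' \<longleftrightarrow> (\<forall>v. v \<in> ?V' \<longrightarrow> (\<exists>!f. f \<in> ?F \<and> v \<in> h f))"
    proof -
      have "h f \<subseteq> ?V'" if "f \<in> ?F" for f
        using sub[OF that] vf[OF that] core(1) that by blast
      then show ?thesis using h unfolding H_def by blast
    qed
    also have "\<dots> \<longleftrightarrow> co h \<in> H ?V"
      unfolding * H_def using co_PiE[of h] by blast
    finally show ?thesis .
  qed
  have "matching_sum (aztec_darts (Suc k) c) ?V' y =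
      (\<Sum>h\<in>H ?V'. \<Prod>f\<in>?F. matching_sum (boundary f) (h f) y)"
    unfolding H_def by (rule aztec_matching_sum[OF par])
  also have "\<dots> = (\<Sum>h\<in>H ?V'. (\<Prod>f\<in>?F. \<Delta> f) * (\<Prod>f\<in>?F. matching_sum (boundary f) (co h f) y'))"
  proof (rule sum.cong[OF refl])
    fix h assume "h \<in> H ?V'"
    then have h: "h \<in> PiE ?F (\<lambda>f. Pow (corners f))" by (simp add: H_def)
    have "h f \<subseteq> corners f" if "f \<in> ?F" for f
      using PiE_mem[OF h that] by (simp only: Pow_iff)
    then show "(\<Prod>f\<in>?F. matching_sum (boundary f) (h f) y) =
        (\<Prod>f\<in>?F. \<Delta> f) * (\<Prod>f\<in>?F. matching_sum (boundary f) (co h f) y')"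
      by (simp add: y' co_def flip: prod.distrib del: corners.simps)
  qed
  also have "\<dots> = (\<Prod>f\<in>?F. \<Delta> f) * (\<Sum>h\<in>H ?V'. \<Prod>f\<in>?F. matching_sum (boundary f) (co h f) y')"
    by (simp add: sum_distrib_left)
  also have "(\<Sum>h\<in>H ?V'. \<Prod>f\<in>?F. matching_sum (boundary f) (co h f) y') =
      (\<Sum>h\<in>H ?V. \<Prod>f\<in>?F. matching_sum (boundary f) (h f) y')"
  proof (rule sum.reindex_bij_witness[where i = co and j = co])
    fix h assume h: "h \<in> H ?V'"
    then have P: "h \<in> PiE ?F (\<lambda>f. Pow (corners f))" by (simp add: H_def)
    show "co (co h) = h" "co h \<in> H ?V" using co_co[OF P] H_co[OF P] h by blast+
  next
    fix h assume h: "h \<in> H ?V"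
    then have P: "h \<in> PiE ?F (\<lambda>f. Pow (corners f))" by (simp add: H_def)
    show "co (co h) = h" by (rule co_co[OF P])
    then show "co h \<in> H ?V'" using H_co[OF co_PiE, of h] h by simp
  qed simp
  also have "\<dots> = matching_sum (aztec_darts (Suc k) c) ?V y'"
    unfolding H_def by (rule aztec_matching_sum[OF par, symmetric])
  \<comment> \<open>After the exchange the dart set is still that of the large diamond, but darts
    leaving the small vertex set cannot be used.\<close>
  also have "\<dots> = matching_sum (aztec_darts k c) ?V y'"
  proof (rule matching_sum_restrict[symmetric])
    show "aztec_darts k c \<subseteq> aztec_darts (Suc k) c"
      unfolding aztec_darts_def using internal_faces_Suc by blast
  qed (rule aztec_darts_restrict)
  finally show ?thesis .
qed

section \<open>Signed dart weights and the dSKP map\<close>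

lemma oriented_dimers_perfect: "oriented_dimers k c = perfect_matchings (aztec_darts k c) (aztec_vertices k c)"
proof -
  have "ends e \<subseteq> aztec_vertices k c" if "e \<in> aztec_darts k c" for e
    using that unfolding aztec_darts_def aztec_vertices_def by (blast dest: subsetD[OF ends_boundary])
  then show ?thesis
    unfolding oriented_dimers_def perfect_matchings_def by (auto simp: ends_def)
qed

definition dart_weight :: "(dart \<Rightarrow> int) \<Rightarrow> (face \<Rightarrow> complex) \<Rightarrow> dart \<Rightarrow> complex" where
  "dart_weight \<phi> b e = of_int (\<phi> e) * b (right_face e)"

lemma partition_function_matching_sum:
  "partition_function \<phi> k c b = matching_sum (aztec_darts k c) (aztec_vertices k c) (dart_weight \<phi> b)"
  by (simp add: partition_function_def matching_sum_def oriented_dimers_perfect dart_weight_def)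

text \<open>Solving \<open>(e - n) * (c - w) * (s - c') = (n - c) * (w - s) * (e - c')\<close> for
  c' gives \<open>dskp_num / dskp_den\<close>. With Kasteleyn signs, the denominator is up to sign
  also the matching sum of the four-cycle around c, whose edge weights are the differences to
  c.\<close>

definition dskp_den :: "complex \<Rightarrow> complex \<Rightarrow> complex \<Rightarrow> complex \<Rightarrow> complex \<Rightarrow> complex" where
  "dskp_den c n e s w = (c - n) * (c - s) - (c - e) * (c - w)"

definition dskp_num :: "complex \<Rightarrow> complex \<Rightarrow> complex \<Rightarrow> complex \<Rightarrow> complex \<Rightarrow> complex" where
  "dskp_num c n e s w = c * (e * w - n * s) - (e * s * w + n * e * w - n * s * w - n * s * e)"

lemma dskp_diff:
  "dskp_num c n e s w - n * dskp_den c n e s w = (n - e) * (n - w) * (c - s)"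
  "dskp_num c n e s w - e * dskp_den c n e s w = - ((e - n) * (e - s) * (c - w))"
  "dskp_num c n e s w - s * dskp_den c n e s w = (s - e) * (s - w) * (c - n)"
  "dskp_num c n e s w - w * dskp_den c n e s w = - ((w - n) * (w - s) * (c - e))"
  unfolding dskp_num_def dskp_den_def by algebra+

fun at_face :: "(complex \<Rightarrow> complex \<Rightarrow> complex \<Rightarrow> complex \<Rightarrow> complex \<Rightarrow> complex) \<Rightarrow>
    (face \<Rightarrow> complex) \<Rightarrow> face \<Rightarrow> complex" where
  "at_face g b (i, j) = g (b (i, j)) (b (i, j + 1)) (b (i + 1, j)) (b (i, j - 1)) (b (i - 1, j))"

definition evolve :: "int \<Rightarrow> (face \<Rightarrow> complex) \<Rightarrow> face \<Rightarrow> complex" where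
  "evolve s b f = (if even (fst f + snd f + s) then at_face dskp_num b f / at_face dskp_den b f else b f)"

text \<open>A vertex lies between two core faces (those with even i + j + s) and two other faces. Seen from
  one core face, the factor in the edge weights is the weight of the vertical neighbour minus that of
  the horizontal one; seen from the other, it has the opposite sign. The sign (-1)^p makes both agree.\<close>

fun vertex_gauge :: "int \<Rightarrow> (face \<Rightarrow> complex) \<Rightarrow> vertex \<Rightarrow> complex" where
  "vertex_gauge s b (p, q) = (if even p then 1 else -1) *
     (if even (p + q + s) then b (p, q + 1) - b (p + 1, q) else b (p, q) - b (p + 1, q + 1))"

text \<open>The signs of two opposite edges, both traversed around the face. The Kasteleyn condition
  gives the other two the opposite product, so the two matchings of the four-cycle combine to this
  sign times \<open>dskp_den\<close>.\<close>

fun face_sign :: "(dart \<Rightarrow> int) \<Rightarrow> face \<Rightarrow> int" where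
  "face_sign \<phi> (i, j) = \<phi> ((i, j), (i - 1, j)) * \<phi> ((i - 1, j - 1), (i, j - 1))"

text \<open>The definition directs edges from white to black; going around the face instead reverses
  two of the four, which leaves the product at -1.\<close>

lemma kasteleyn_face:
  assumes "kasteleyn k c \<phi>" and "(i, j) \<in> internal_faces k c"
  shows "\<And>v w. (v, w) \<in> boundary (i, j) \<Longrightarrow> \<phi> (v, w) \<in> {-1, 1} \<and> \<phi> (w, v) = - \<phi> (v, w)"
    and "\<phi> ((i, j), (i - 1, j)) * \<phi> ((i - 1, j), (i - 1, j - 1)) *
         \<phi> ((i - 1, j - 1), (i, j - 1)) * \<phi> ((i, j - 1), (i, j)) = -1"
proof -
  show \<phi>: "\<phi> (v, w) \<in> {-1, 1} \<and> \<phi> (w, v) = - \<phi> (v, w)" if "(v, w) \<in> boundary (i, j)" for v w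
    using assms that unfolding kasteleyn_def aztec_darts_def by blast
  have anti: "\<phi> ((i - 1, j), (i, j)) = - \<phi> ((i, j), (i - 1, j))"
    "\<phi> ((i - 1, j - 1), (i - 1, j)) = - \<phi> ((i - 1, j), (i - 1, j - 1))"
    "\<phi> ((i, j - 1), (i - 1, j - 1)) = - \<phi> ((i - 1, j - 1), (i, j - 1))"
    "\<phi> ((i, j), (i, j - 1)) = - \<phi> ((i, j - 1), (i, j))"
    by (rule conjunct2[OF \<phi>], simp add: boundary_square square_def)+
  have "(\<Prod>e | e \<in> boundary (i, j) \<and> white (fst e). \<phi> e) = -1"
    using assms unfolding kasteleyn_def by blast
  then show "\<phi> ((i, j), (i - 1, j)) * \<phi> ((i - 1, j), (i - 1, j - 1)) *
         \<phi> ((i - 1, j - 1), (i, j - 1)) * \<phi> ((i, j - 1), (i, j)) = -1"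
    unfolding boundary_white by (simp add: anti algebra_simps split: if_splits)
qed

lemma kasteleyn_Suc: "kasteleyn (Suc k) c \<phi> \<Longrightarrow> kasteleyn k c \<phi>"
  unfolding kasteleyn_def aztec_darts_def using internal_faces_Suc[of k c] by blast


subsection \<open>The spider move\<close>

lemma sym_weight_dart_weight:
  assumes "\<phi> (w, v) = - \<phi> (v, w)"
  shows "sym_weight (dart_weight \<phi> b) v w =
    of_int (\<phi> (v, w)) * (b (right_face (v, w)) - b (right_face (w, v)))"
  using assms by (simp add: sym_weight_def dart_weight_def algebra_simps)

text \<open>By \<open>dskp_diff\<close>, each new edge weight is the opposite old one times the
  gauges of its two ends, over the denominator. Since every edge sees a product of two gauges, the
  common sign \<open>\<epsilon>\<close> of the four corners and the sign \<open>\<tau>\<close> drop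
  out of this local identity.\<close>

lemma spider_move:
  assumes \<phi>: "kasteleyn k c \<phi>" and f: "f \<in> internal_faces k c" and par: "even (fst f + snd f + s)"
    and den: "at_face dskp_den b f \<noteq> 0"
    and gauge: "\<And>v. v \<in> corners f \<Longrightarrow> vertex_gauge s b v \<noteq> 0" and \<tau>: "\<tau> * \<tau> = 1"
    and S: "S \<subseteq> corners f"
  shows "matching_sum (boundary f) S (dart_weight \<phi> b) =
    of_int (face_sign \<phi> f) * at_face dskp_den b f *
    matching_sum (boundary f) (corners f - S)
      (\<lambda>e. dart_weight \<phi> (evolve s b) e / ((\<tau> * vertex_gauge s b (fst e)) * (\<tau> * vertex_gauge s b (snd e))))"
proof -
  obtain i j where ij: "f = (i, j)" by (cases f)
  have par': "even (i + j + s)" using par by (simp add: ij)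
  define C N E S' W where "C = b (i, j)" and "N = b (i, j + 1)" and "E = b (i + 1, j)"
    and "S' = b (i, j - 1)" and "W = b (i - 1, j)"
  note defs = C_def N_def E_def S'_def W_def
  define D where "D = dskp_den C N E S' W"
  define C' where "C' = dskp_num C N E S' W / D"
  have D: "D \<noteq> 0" using den by (simp add: ij D_def defs)
  have atD: "at_face dskp_den b f = D" by (simp add: ij D_def defs)
  have ev: "evolve s b (i, j) = C'" "evolve s b (i, j + 1) = N" "evolve s b (i + 1, j) = E"
    "evolve s b (i, j - 1) = S'" "evolve s b (i - 1, j) = W"
    using par' by (auto simp: evolve_def C'_def D_def defs)
  have mult: "C' * D = dskp_num C N E S' W" using D by (simp add: C'_def)
  have diff: "(C' - N) * D = (N - E) * (N - W) * (C - S')" "(C' - E) * D = - ((E - N) * (E - S') * (C - W))"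
    "(C' - S') * D = (S' - E) * (S' - W) * (C - N)" "(C' - W) * D = - ((W - N) * (W - S') * (C - E))"
    using dskp_diff[of C N E S' W] by (simp_all add: left_diff_distrib mult flip: D_def)
  define \<epsilon> :: complex where "\<epsilon> = (if even i then 1 else -1)"
  have \<epsilon>: "\<epsilon> * \<epsilon> = 1" by (simp add: \<epsilon>_def)
  have g: "vertex_gauge s b (i, j) = \<epsilon> * (N - E)" "vertex_gauge s b (i - 1, j) = \<epsilon> * (N - W)"
    "vertex_gauge s b (i - 1, j - 1) = \<epsilon> * (S' - W)" "vertex_gauge s b (i, j - 1) = \<epsilon> * (S' - E)"
    using par' by (auto simp: \<epsilon>_def defs)
  have ne: "N - E \<noteq> 0" "N - W \<noteq> 0" "S' - W \<noteq> 0" "S' - E \<noteq> 0"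
    using gauge[of "(i, j)"] gauge[of "(i - 1, j)"] gauge[of "(i - 1, j - 1)"] gauge[of "(i, j - 1)"]
    unfolding g by (auto simp: ij)
  let ?a = "(i, j)" and ?b = "(i - 1, j)" and ?c = "(i - 1, j - 1)" and ?d = "(i, j - 1)"
  have rf: "right_face (?a, ?b) = (i, j + 1)" "right_face (?b, ?a) = (i, j)"
    "right_face (?b, ?c) = (i - 1, j)" "right_face (?c, ?b) = (i, j)"
    "right_face (?c, ?d) = (i, j - 1)" "right_face (?d, ?c) = (i, j)"
    "right_face (?d, ?a) = (i + 1, j)" "right_face (?a, ?d) = (i, j)"
    by simp_all
  define p q r t where "p = (of_int (\<phi> (?a, ?b)) :: complex)" and "q = (of_int (\<phi> (?b, ?c)) :: complex)"
    and "r = (of_int (\<phi> (?c, ?d)) :: complex)" and "t = (of_int (\<phi> (?d, ?a)) :: complex)"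
  note kf = kasteleyn_face[OF \<phi> f[unfolded ij]]
  have bd: "(?a, ?b) \<in> boundary (i, j)" "(?b, ?c) \<in> boundary (i, j)" "(?c, ?d) \<in> boundary (i, j)"
    "(?d, ?a) \<in> boundary (i, j)"
    by (simp_all add: boundary_square square_def)
  note k = kf(1)[OF bd(1)] kf(1)[OF bd(2)] kf(1)[OF bd(3)] kf(1)[OF bd(4)]
  have pm: "p * p = 1" "q * q = 1" "r * r = 1" "t * t = 1"
    using k unfolding p_def q_def r_def t_def by auto
  have "(of_int (\<phi> (?a, ?b) * \<phi> (?b, ?c) * \<phi> (?c, ?d) * \<phi> (?d, ?a)) :: complex) = of_int (-1)"
    by (simp only: kf(2))
  then have pqrt: "p * q * r * t = -1"
    by (simp add: p_def q_def r_def t_def)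
  let ?y = "dart_weight \<phi> b"
  have y: "sym_weight ?y ?a ?b = p * (N - C)" "sym_weight ?y ?b ?c = q * (W - C)"
    "sym_weight ?y ?c ?d = r * (S' - C)" "sym_weight ?y ?d ?a = t * (E - C)"
    using k by (simp_all add: sym_weight_dart_weight rf p_def q_def r_def t_def defs del: right_face.simps)
  let ?y' = "\<lambda>e. dart_weight \<phi> (evolve s b) e / ((\<tau> * vertex_gauge s b (fst e)) * (\<tau> * vertex_gauge s b (snd e)))"
  have sw': "sym_weight ?y' v w = sym_weight (dart_weight \<phi> (evolve s b)) v w / (vertex_gauge s b v * vertex_gauge s b w)" for v w
  proof -
    have "\<tau> * vertex_gauge s b v * (\<tau> * vertex_gauge s b w) = (\<tau> * \<tau>) * (vertex_gauge s b v * vertex_gauge s b w)" for v w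
      by (simp only: ac_simps)
    then have \<tau>\<tau>: "\<tau> * vertex_gauge s b v * (\<tau> * vertex_gauge s b w) = vertex_gauge s b v * vertex_gauge s b w" for v w
      by (simp add: \<tau>)
    show ?thesis
      unfolding sym_weight_def fst_conv snd_conv \<tau>\<tau>
      by (simp add: add_divide_distrib mult.commute)
  qed
  have gg: "vertex_gauge s b ?a * vertex_gauge s b ?b = (N - E) * (N - W)" "vertex_gauge s b ?b * vertex_gauge s b ?c = (N - W) * (S' - W)"
    "vertex_gauge s b ?c * vertex_gauge s b ?d = (S' - W) * (S' - E)" "vertex_gauge s b ?d * vertex_gauge s b ?a = (S' - E) * (N - E)"
    unfolding g using \<epsilon> by algebra+
  have y': "sym_weight ?y' ?a ?b = p * (N - C') / ((N - E) * (N - W))"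
    "sym_weight ?y' ?b ?c = q * (W - C') / ((N - W) * (S' - W))"
    "sym_weight ?y' ?c ?d = r * (S' - C') / ((S' - W) * (S' - E))"
    "sym_weight ?y' ?d ?a = t * (E - C') / ((S' - E) * (N - E))"
    unfolding sw' gg
    using k by (simp_all add: sym_weight_dart_weight rf p_def q_def r_def t_def ev
        del: right_face.simps vertex_gauge.simps)
  define \<Delta> where "\<Delta> = of_int (face_sign \<phi> f) * D"
  have qt: "q * t = - (p * r)" using pqrt pm by algebra
  have \<Delta>: "\<Delta> = p * r * D" by (simp add: \<Delta>_def ij p_def r_def)
  have pr: "p \<noteq> 0" "r \<noteq> 0" using pm by auto
  have "matching_sum (square ?a ?b ?c ?d) S ?y =
      \<Delta> * matching_sum (square ?a ?b ?c ?d) ({?a, ?b, ?c, ?d} - S) ?y'"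
  proof (rule matching_sum_square_complement)
    show "distinct [?a, ?b, ?c, ?d]" by simp
    show "\<Delta> = sym_weight ?y ?a ?b * sym_weight ?y ?c ?d + sym_weight ?y ?b ?c * sym_weight ?y ?d ?a"
      unfolding y \<Delta> D_def dskp_den_def using qt by algebra
    show "\<Delta> \<noteq> 0" using \<Delta> D pr by simp
    show "sym_weight ?y' ?a ?b * \<Delta> = sym_weight ?y ?c ?d"
    proof -
      have "p * (N - C') * \<Delta> = r * (S' - C) * ((N - E) * (N - W))"
        unfolding \<Delta> using diff(1) pm(1) by algebra
      then show ?thesis unfolding y y' using ne by (simp add: divide_simps)
    qed
    show "sym_weight ?y' ?c ?d * \<Delta> = sym_weight ?y ?a ?b"
    proof -
      have "r * (S' - C') * \<Delta> = p * (N - C) * ((S' - W) * (S' - E))"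
        unfolding \<Delta> using diff(3) pm(3) by algebra
      then show ?thesis unfolding y y' using ne by (simp add: divide_simps)
    qed
    have \<Delta>': "\<Delta> = - (q * t * D)" unfolding \<Delta> qt by simp
    show "sym_weight ?y' ?b ?c * \<Delta> = sym_weight ?y ?d ?a"
    proof -
      have "q * (W - C') * \<Delta> = t * (E - C) * ((N - W) * (S' - W))"
        unfolding \<Delta>' using diff(4) pm(2) by algebra
      then show ?thesis unfolding y y' using ne by (simp add: divide_simps)
    qed
    show "sym_weight ?y' ?d ?a * \<Delta> = sym_weight ?y ?b ?c"
    proof -
      have "t * (E - C') * \<Delta> = q * (W - C) * ((S' - E) * (N - E))"
        unfolding \<Delta>' using diff(2) pm(4) by algebra
      then show ?thesis unfolding y y' using ne by (simp add: divide_simps)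
    qed
    show "S \<subseteq> {?a, ?b, ?c, ?d}" using S unfolding ij corners_square .
  qed
  then show ?thesis
    unfolding atD unfolding ij corners_square boundary_square \<Delta>_def .
qed

text \<open>The sign \<open>\<tau>\<close> will be -1 for inverse weights, since 1/a - 1/b = - (a - b) / (a b).\<close>

lemma partition_function_Suc:
  assumes par: "even (fst c + snd c + s + int k)" and \<phi>: "kasteleyn (Suc k) c \<phi>"
    and den: "\<And>f. f \<in> core_faces s (Suc k) c \<Longrightarrow> at_face dskp_den b f \<noteq> 0"
    and gauge: "\<And>v. v \<in> aztec_vertices (Suc k) c \<Longrightarrow> vertex_gauge s b v \<noteq> 0" and \<tau>: "\<tau> * \<tau> = 1"
  shows "partition_function \<phi> (Suc k) c b * (\<Prod>v\<in>aztec_vertices k c. \<tau> * vertex_gauge s b v) =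
    (\<Prod>f\<in>core_faces s (Suc k) c. of_int (face_sign \<phi> f) * at_face dskp_den b f) *
    partition_function \<phi> k c (evolve s b)"
proof -
  let ?V = "aztec_vertices k c"
  let ?y' = "\<lambda>e. dart_weight \<phi> (evolve s b) e / ((\<tau> * vertex_gauge s b (fst e)) * (\<tau> * vertex_gauge s b (snd e)))"
  have \<tau>0: "\<tau> \<noteq> 0" using \<tau> by auto
  have "partition_function \<phi> (Suc k) c b =
      (\<Prod>f\<in>core_faces s (Suc k) c. of_int (face_sign \<phi> f) * at_face dskp_den b f) *
      matching_sum (aztec_darts k c) ?V ?y'"
    unfolding partition_function_matching_sum
  proof (rule urban_renewal[OF par])
    fix f S assume f: "f \<in> core_faces s (Suc k) c" "S \<subseteq> corners f"
    then have f': "f \<in> internal_faces (Suc k) c" "even (fst f + snd f + s)"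
      by (auto simp: core_faces_def)
    have "vertex_gauge s b v \<noteq> 0" if "v \<in> corners f" for v
      using gauge f'(1) that unfolding aztec_vertices_def by blast
    then show "matching_sum (boundary f) S (dart_weight \<phi> b) =
        of_int (face_sign \<phi> f) * at_face dskp_den b f * matching_sum (boundary f) (corners f - S) ?y'"
      by (intro spider_move[OF \<phi> f' den[OF f(1)] _ \<tau> f(2)])
  qed
  moreover have "matching_sum (aztec_darts k c) ?V (dart_weight \<phi> (evolve s b)) =
      (\<Prod>v\<in>?V. \<tau> * vertex_gauge s b v) * matching_sum (aztec_darts k c) ?V ?y'"
  proof (rule matching_sum_gauge[OF finite_aztec_vertices])
    fix e assume e: "e \<in> aztec_darts k c"
    then show "fst e \<noteq> snd e" by (auto simp: aztec_darts_def boundary_def)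
    assume "ends e \<subseteq> ?V"
    moreover have "?V \<subseteq> aztec_vertices (Suc k) c"
      unfolding aztec_vertices_def using internal_faces_Suc by blast
    ultimately have "vertex_gauge s b (fst e) \<noteq> 0" "vertex_gauge s b (snd e) \<noteq> 0"
      using gauge unfolding ends_def by blast+
    then show "dart_weight \<phi> (evolve s b) e = (\<tau> * vertex_gauge s b (fst e)) * (\<tau> * vertex_gauge s b (snd e)) * ?y' e"
      using \<tau>0 by simp
  qed
  ultimately show ?thesis
    unfolding partition_function_matching_sum by (simp add: mult_ac)
qed


subsection \<open>Face weights\<close>

lemma fdist_commute: "fdist f g = fdist g f"
  by (cases f; cases g) (simp add: abs_minus_commute)

lemma fdist_1: "{f. fdist (i, j) f = 1} = {(i, j + 1), (i + 1, j), (i, j - 1), (i - 1, j)}"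
proof (intro equalityI subsetI)
  fix f assume "f \<in> {f. fdist (i, j) f = 1}"
  then obtain p q where f: "f = (p, q)" and "\<bar>p - i\<bar> + \<bar>q - j\<bar> = 1"
    by (cases f) auto
  then have "p = i + 1 \<and> q = j \<or> p = i - 1 \<and> q = j \<or> p = i \<and> q = j + 1 \<or> p = i \<and> q = j - 1"
    by arith
  then show "f \<in> {(i, j + 1), (i + 1, j), (i, j - 1), (i - 1, j)}" using f by auto
qed auto

text \<open>An identity of exponents: for a face that does not evolve, 1 plus the number of its
  corners in the small diamond equals the number of its core neighbours, plus 1 if it is a face of
  the small diamond. In the interior this reads 1 + 4 = 4 + 1; on open faces of the large diamond 1
  + 1 = 2 + 0, and 1 + 0 = 1 + 0 at the four tips.\<close>

lemma face_count:
  fixes a :: complex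
  assumes par: "even (x + y + s + int k)" and od: "odd (i + j + s)"
    and o: "\<bar>i - x\<bar> + \<bar>j - y\<bar> \<le> int k + 1"
  defines "In \<equiv> \<lambda>f. if f \<in> core_faces s (Suc k) (x, y) then a else 1"
    and "Inv \<equiv> \<lambda>v. if v \<in> aztec_vertices k (x, y) then a else 1"
  shows "a * (Inv (i, j) * Inv (i - 1, j) * Inv (i - 1, j - 1) * Inv (i, j - 1)) =
    In (i, j + 1) * In (i + 1, j) * In (i, j - 1) * In (i - 1, j) *
    (if (i, j) \<in> all_faces k (x, y) then a else 1)"
proof -
  define X Y where "X = i - x" and "Y = j - y"
  have ij: "i = X + x" "j = Y + y" by (simp_all add: X_def Y_def)
  have core: "(i, j + 1) \<in> core_faces s (Suc k) (x, y) \<longleftrightarrow> \<bar>X\<bar> + \<bar>Y + 1\<bar> \<le> int k"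
    "(i + 1, j) \<in> core_faces s (Suc k) (x, y) \<longleftrightarrow> \<bar>X + 1\<bar> + \<bar>Y\<bar> \<le> int k"
    "(i, j - 1) \<in> core_faces s (Suc k) (x, y) \<longleftrightarrow> \<bar>X\<bar> + \<bar>Y - 1\<bar> \<le> int k"
    "(i - 1, j) \<in> core_faces s (Suc k) (x, y) \<longleftrightarrow> \<bar>X - 1\<bar> + \<bar>Y\<bar> \<le> int k"
    using od by (auto simp: mem_core_faces ij algebra_simps)
  have par': "even (fst (x, y) + snd (x, y) + s + int k)" using par by simp
  have vert: "(i, j) \<in> aztec_vertices k (x, y) \<longleftrightarrow>
      (i + 1, j) \<in> core_faces s (Suc k) (x, y) \<and> (i, j + 1) \<in> core_faces s (Suc k) (x, y)"
    "(i - 1, j) \<in> aztec_vertices k (x, y) \<longleftrightarrow>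
      (i - 1, j) \<in> core_faces s (Suc k) (x, y) \<and> (i, j + 1) \<in> core_faces s (Suc k) (x, y)"
    "(i - 1, j - 1) \<in> aztec_vertices k (x, y) \<longleftrightarrow>
      (i, j - 1) \<in> core_faces s (Suc k) (x, y) \<and> (i - 1, j) \<in> core_faces s (Suc k) (x, y)"
    "(i, j - 1) \<in> aztec_vertices k (x, y) \<longleftrightarrow>
      (i, j - 1) \<in> core_faces s (Suc k) (x, y) \<and> (i + 1, j) \<in> core_faces s (Suc k) (x, y)"
    unfolding aztec_vertices_core(2)[OF par'] using od by auto
  have all: "(i, j) \<in> all_faces k (x, y) \<longleftrightarrow> \<bar>X\<bar> + \<bar>Y\<bar> \<le> int k"
    by (simp add: mem_all_faces X_def Y_def)
  have "odd (X + Y + int k)" using od par unfolding ij by simp blast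
  then have odd: "odd (\<bar>X\<bar> + \<bar>Y\<bar> + int k)" by simp
  have ne: "A \<noteq> B" if "odd (A + B)" for A B :: int using that by auto
  from ne[OF odd] o have "\<bar>X\<bar> + \<bar>Y\<bar> \<le> int k - 1 \<or> \<bar>X\<bar> + \<bar>Y\<bar> = int k + 1"
    unfolding X_def Y_def by linarith
  then show ?thesis
  proof
    assume *: "\<bar>X\<bar> + \<bar>Y\<bar> \<le> int k - 1"
    have "\<bar>X\<bar> + \<bar>Y + 1\<bar> \<le> int k" "\<bar>X + 1\<bar> + \<bar>Y\<bar> \<le> int k" "\<bar>X\<bar> + \<bar>Y - 1\<bar> \<le> int k"
      "\<bar>X - 1\<bar> + \<bar>Y\<bar> \<le> int k" "\<bar>X\<bar> + \<bar>Y\<bar> \<le> int k"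
      using * by linarith+
    then show ?thesis unfolding In_def Inv_def vert core all by simp
  next
    assume *: "\<bar>X\<bar> + \<bar>Y\<bar> = int k + 1"
    have n: "\<bar>X\<bar> + \<bar>Y + 1\<bar> \<le> int k \<longleftrightarrow> Y < 0" and e: "\<bar>X + 1\<bar> + \<bar>Y\<bar> \<le> int k \<longleftrightarrow> X < 0"
      and s: "\<bar>X\<bar> + \<bar>Y - 1\<bar> \<le> int k \<longleftrightarrow> Y > 0" and w: "\<bar>X - 1\<bar> + \<bar>Y\<bar> \<le> int k \<longleftrightarrow> X > 0"
      and a: "\<not> \<bar>X\<bar> + \<bar>Y\<bar> \<le> int k"
      using * by linarith+
    have "X \<noteq> 0 \<or> Y \<noteq> 0" using * by auto
    then show ?thesis
      unfolding In_def Inv_def vert core all n e s w using a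
      by (cases X "0::int" rule: linorder_cases; cases Y "0::int" rule: linorder_cases) simp_all
  qed
qed

text \<open>This identity makes the weights of the faces that do not evolve cancel in the ratio function.\<close>

lemma prod_weights:
  fixes b :: "face \<Rightarrow> complex"
  assumes par: "even (fst c + snd c + s + int k)"
  defines "Od \<equiv> \<lambda>k. {f \<in> all_faces k c. odd (fst f + snd f + s)}"
  shows "(\<Prod>f\<in>Od (Suc k). b f) * (\<Prod>v\<in>aztec_vertices k c. \<Prod>f\<in>vertex_faces (s + 1) v. b f) =
    (\<Prod>f\<in>core_faces s (Suc k) c. \<Prod>f'\<in>{f'. fdist f f' = 1}. b f') * (\<Prod>f\<in>Od k. b f)"
proof -
  obtain x y where c: "c = (x, y)" by (cases c)
  let ?O = "Od (Suc k)" and ?V = "aztec_vertices k c" and ?F = "core_faces s (Suc k) c"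
  have fin: "finite ?O" unfolding Od_def by (simp add: finite_all_faces)
  have sub: "vertex_faces (s + 1) v \<subseteq> ?O" if "v \<in> ?V" for v
  proof -
    obtain p q where v: "v = (p, q)" by (cases v)
    have d: "\<bar>2 * p + 1 - 2 * x\<bar> + \<bar>2 * q + 1 - 2 * y\<bar> \<le> 2 * int k"
      using that by (simp add: mem_aztec_vertices v c)
    have "\<bar>p - x\<bar> + \<bar>q - y\<bar> \<le> int k + 1" "\<bar>p + 1 - x\<bar> + \<bar>q - y\<bar> \<le> int k + 1"
      "\<bar>p - x\<bar> + \<bar>q + 1 - y\<bar> \<le> int k + 1" "\<bar>p + 1 - x\<bar> + \<bar>q + 1 - y\<bar> \<le> int k + 1"
      using d by linarith+
    then show ?thesis by (auto simp: Od_def v c mem_all_faces)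
  qed
  have sub': "{f'. fdist f f' = 1} \<subseteq> ?O" if "f \<in> ?F" for f
  proof -
    obtain i j where f: "f = (i, j)" by (cases f)
    have d: "\<bar>i - x\<bar> + \<bar>j - y\<bar> \<le> int k" "even (i + j + s)"
      using that by (simp_all add: mem_core_faces f c)
    have "\<bar>i + 1 - x\<bar> + \<bar>j - y\<bar> \<le> int k + 1" "\<bar>i - 1 - x\<bar> + \<bar>j - y\<bar> \<le> int k + 1"
      "\<bar>i - x\<bar> + \<bar>j + 1 - y\<bar> \<le> int k + 1" "\<bar>i - x\<bar> + \<bar>j - 1 - y\<bar> \<le> int k + 1"
      using d(1) by linarith+
    then show ?thesis using d(2) unfolding f fdist_1 by (auto simp: Od_def c mem_all_faces)
  qed
  \<comment> \<open>Both double products are regrouped by the face whose weight occurs;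
    \<open>face_count\<close> then compares the exponents face by face.\<close>
  have "(\<Prod>v\<in>?V. \<Prod>f\<in>vertex_faces (s + 1) v. b f) = (\<Prod>v\<in>?V. \<Prod>f\<in>{f \<in> ?O. f \<in> vertex_faces (s + 1) v}. b f)"
    using sub by (intro prod.cong refl) blast
  also have "\<dots> = (\<Prod>f\<in>?O. \<Prod>v\<in>{v \<in> ?V. f \<in> vertex_faces (s + 1) v}. b f)"
    by (rule prod.swap_restrict[OF finite_aztec_vertices fin])
  finally have V: "(\<Prod>v\<in>?V. \<Prod>f\<in>vertex_faces (s + 1) v. b f) =
    (\<Prod>f\<in>?O. \<Prod>v\<in>{v \<in> ?V. f \<in> vertex_faces (s + 1) v}. b f)" .
  have "(\<Prod>f\<in>?F. \<Prod>f'\<in>{f'. fdist f f' = 1}. b f') = (\<Prod>f\<in>?F. \<Prod>f'\<in>{f' \<in> ?O. fdist f f' = 1}. b f')"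
    using sub' by (intro prod.cong refl) blast
  also have "\<dots> = (\<Prod>f'\<in>?O. \<Prod>f\<in>{f \<in> ?F. fdist f f' = 1}. b f')"
    by (rule prod.swap_restrict[OF finite_core_faces fin])
  finally have F: "(\<Prod>f\<in>?F. \<Prod>f'\<in>{f'. fdist f f' = 1}. b f') =
    (\<Prod>f'\<in>?O. \<Prod>f\<in>{f \<in> ?F. fdist f f' = 1}. b f')" .
  have "Od k = {f \<in> ?O. f \<in> all_faces k c}"
    by (auto simp: Od_def all_faces_def internal_faces_def open_faces_def)
  then have O: "(\<Prod>f\<in>Od k. b f) = (\<Prod>f\<in>?O. if f \<in> all_faces k c then b f else 1)"
    using prod.inter_filter[OF fin] by simp
  have "b f * (\<Prod>v\<in>{v \<in> ?V. f \<in> vertex_faces (s + 1) v}. b f) =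
      (\<Prod>f'\<in>{f' \<in> ?F. fdist f' f = 1}. b f) * (if f \<in> all_faces k c then b f else 1)"
    if "f \<in> ?O" for f
  proof -
    obtain i j where f: "f = (i, j)" by (cases f)
    have od: "odd (i + j + s)" and d: "\<bar>i - x\<bar> + \<bar>j - y\<bar> \<le> int k + 1"
      using that by (auto simp: Od_def mem_all_faces f c)
    have V_set: "{v \<in> ?V. f \<in> vertex_faces (s + 1) v} = {v \<in> corners f. v \<in> ?V}"
      using od unfolding vertex_faces_iff f by auto
    have "(\<Prod>v\<in>{v \<in> ?V. f \<in> vertex_faces (s + 1) v}. b f) = (\<Prod>v\<in>corners f. if v \<in> ?V then b f else 1)"
      unfolding V_set by (rule prod.inter_filter[OF finite_corners])
    moreover have F_set: "{f' \<in> ?F. fdist f' f = 1} = {f' \<in> {f'. fdist f f' = 1}. f' \<in> ?F}"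
      using fdist_commute[of f] by auto
    have "(\<Prod>f'\<in>{f' \<in> ?F. fdist f' f = 1}. b f) = (\<Prod>f'\<in>{f'. fdist f f' = 1}. if f' \<in> ?F then b f else 1)"
      unfolding F_set by (rule prod.inter_filter) (simp add: f fdist_1)
    ultimately show ?thesis
      using face_count[of x y s k i j "b f"] par od d
      unfolding f c corners_square fdist_1 by (simp add: mult_ac)
  qed
  then show ?thesis
    unfolding V F O by (simp flip: prod.distrib)
qed


subsection \<open>One time step of the ratio function\<close>

lemma partition_function_cong:
  assumes "\<And>f. f \<in> all_faces k c \<Longrightarrow> b f = b' f"
  shows "partition_function \<phi> k c b = partition_function \<phi> k c b'"
  unfolding partition_function_def
proof (intro sum.cong refl prod.cong)
  fix M e assume "M \<in> oriented_dimers k c" "e \<in> M"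
  then have "e \<in> aztec_darts k c" by (auto simp: oriented_dimers_def)
  from right_face_in_all_faces[OF this]
  show "of_int (\<phi> e) * b (right_face e) = of_int (\<phi> e) * b' (right_face e)"
    using assms by simp
qed

lemma neighbours_all_faces:
  assumes "f \<in> internal_faces k c"
  shows "{f'. fdist f f' = 1} \<subseteq> all_faces k c"
proof -
  obtain i j where f: "f = (i, j)" by (cases f)
  obtain x y where c: "c = (x, y)" by (cases c)
  have d: "\<bar>i - x\<bar> + \<bar>j - y\<bar> < int k"
    using assms by (simp add: mem_internal_faces f c)
  have "\<bar>i + 1 - x\<bar> + \<bar>j - y\<bar> \<le> int k" "\<bar>i - 1 - x\<bar> + \<bar>j - y\<bar> \<le> int k"
    "\<bar>i - x\<bar> + \<bar>j + 1 - y\<bar> \<le> int k" "\<bar>i - x\<bar> + \<bar>j - 1 - y\<bar> \<le> int k"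
    using d by linarith+
  then show ?thesis unfolding f fdist_1 by (simp add: c mem_all_faces)
qed

lemma vertex_faces_all_faces:
  assumes "even (fst c + snd c + s + int k)" and "v \<in> aztec_vertices (Suc k) c"
  shows "vertex_faces (s + 1) v \<subseteq> all_faces (Suc k) c"
proof -
  obtain f where f: "f \<in> vertex_faces s v" "f \<in> core_faces s (Suc k) c"
    using assms(2) unfolding aztec_vertices_core(1)[OF assms(1)] by blast
  obtain p q where v: "v = (p, q)" by (cases v)
  have "vertex_faces (s + 1) v \<subseteq> {f'. fdist f f' = 1}"
    using f(1) unfolding v by (auto split: if_splits)
  also have "\<dots> \<subseteq> all_faces (Suc k) c"
    using f(2) by (intro neighbours_all_faces) (simp add: core_faces_def)
  finally show ?thesis .
qed

text \<open>The multi-ratio equation is invariant under inversion of all points, so c' becomes 1/c':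
  numerator and denominator are exchanged, up to a common monomial.\<close>

lemma dskp_inverse:
  assumes "c \<noteq> 0" "n \<noteq> 0" "e \<noteq> 0" "s \<noteq> 0" "w \<noteq> 0"
  shows "dskp_den (inverse c) (inverse n) (inverse e) (inverse s) (inverse w) =
      dskp_num c n e s w / (c * (n * e * s * w))" (is ?A)
    and "dskp_num (inverse c) (inverse n) (inverse e) (inverse s) (inverse w) =
      dskp_den c n e s w / (c * (n * e * s * w))" (is ?B)
proof -
  show ?A
    using assms unfolding dskp_den_def dskp_num_def by (simp add: field_simps power2_eq_square)
  show ?B
    using assms unfolding dskp_den_def dskp_num_def by (simp add: field_simps power2_eq_square)
qed

lemma at_face_inverse:
  assumes "b f \<noteq> 0" "\<And>f'. fdist f f' = 1 \<Longrightarrow> b f' \<noteq> 0"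
  shows "at_face dskp_den (\<lambda>f. inverse (b f)) f = at_face dskp_num b f / (b f * (\<Prod>f'\<in>{f'. fdist f f' = 1}. b f'))"
    and "at_face dskp_num (\<lambda>f. inverse (b f)) f = at_face dskp_den b f / (b f * (\<Prod>f'\<in>{f'. fdist f f' = 1}. b f'))"
proof -
  obtain i j where f: "f = (i, j)" by (cases f)
  have "(\<Prod>f'\<in>{f'. fdist f f' = 1}. b f') = b (i, j + 1) * b (i + 1, j) * b (i, j - 1) * b (i - 1, j)"
    unfolding f fdist_1 by (simp add: mult_ac)
  moreover have "b (i, j) \<noteq> 0" "b (i, j + 1) \<noteq> 0" "b (i + 1, j) \<noteq> 0" "b (i, j - 1) \<noteq> 0" "b (i - 1, j) \<noteq> 0"
    using assms unfolding f by auto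
  ultimately show "at_face dskp_den (\<lambda>f. inverse (b f)) f = at_face dskp_num b f / (b f * (\<Prod>f'\<in>{f'. fdist f f' = 1}. b f'))"
    and "at_face dskp_num (\<lambda>f. inverse (b f)) f = at_face dskp_den b f / (b f * (\<Prod>f'\<in>{f'. fdist f f' = 1}. b f'))"
    unfolding f at_face.simps by (simp_all add: dskp_inverse)
qed

lemma evolve_inverse:
  assumes "b f \<noteq> 0" "\<And>f'. fdist f f' = 1 \<Longrightarrow> b f' \<noteq> 0" 
  shows "evolve s (\<lambda>f. inverse (b f)) f = inverse (evolve s b f)"
proof -
  obtain i j where f: "f = (i, j)" by (cases f)
  have "(\<Prod>f'\<in>{f'. fdist f f' = 1}. b f') \<noteq> 0"
    using assms(2) unfolding f fdist_1 by simp
  then show ?thesis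
    unfolding evolve_def using assms by (simp add: at_face_inverse)
qed

lemma gauge_inverse:
  assumes "\<And>f. f \<in> vertex_faces (s + 1) v \<Longrightarrow> b f \<noteq> 0"
  shows "vertex_gauge s (\<lambda>f. inverse (b f)) v = - vertex_gauge s b v / (\<Prod>f\<in>vertex_faces (s + 1) v. b f)"
proof -
  obtain p q where v: "v = (p, q)" by (cases v)
  show ?thesis
    using assms unfolding v by (simp add: field_simps split: if_splits)
qed

text \<open>A nonzero numerator has two uses: up to a monomial it is the denominator for the inverse
  weights, and it keeps the evolved weights nonzero.\<close>

definition generic_weights :: "int \<Rightarrow> nat \<Rightarrow> face \<Rightarrow> (face \<Rightarrow> complex) \<Rightarrow> bool" where
  "generic_weights s k c b \<longleftrightarrow>
     (\<forall>f\<in>all_faces k c. b f \<noteq> 0) \<and> (\<forall>v\<in>aztec_vertices k c. vertex_gauge s b v \<noteq> 0) \<and>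
     (\<forall>f\<in>core_faces s k c. at_face dskp_num b f \<noteq> 0 \<and> at_face dskp_den b f \<noteq> 0)"

lemma face_sign_ne_0:
  assumes "kasteleyn k c \<phi>" "f \<in> internal_faces k c"
  shows "face_sign \<phi> f \<noteq> 0"
proof -
  obtain i j where f: "f = (i, j)" by (cases f)
  have "((i, j), (i - 1, j)) \<in> boundary f" "((i - 1, j - 1), (i, j - 1)) \<in> boundary f"
    by (simp_all add: f boundary_square square_def)
  with kasteleyn_face(1)[OF assms(1), of i j] assms(2) show ?thesis
    unfolding f by fastforce
qed

lemma all_faces_Suc: "all_faces k c \<subseteq> internal_faces (Suc k) c"
  by (auto simp: all_faces_def internal_faces_def open_faces_def)

lemma all_faces_internal: "internal_faces k c \<subseteq> all_faces k c"
  by (simp add: all_faces_def)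

lemma core_faces_all_faces:
  assumes "even (fst c + snd c + s + int k)"
  shows "core_faces s (Suc k) c = {f \<in> all_faces k c. even (fst f + snd f + s)}"
    and "{f \<in> all_faces (Suc k) c. even (fst f + snd f + s)} = core_faces s (Suc k) c"
proof -
  show "core_faces s (Suc k) c = {f \<in> all_faces k c. even (fst f + snd f + s)}"
    by (auto simp: core_faces_def all_faces_def internal_faces_def open_faces_def)
  have "f \<in> internal_faces (Suc k) c" if f: "f \<in> all_faces (Suc k) c" "even (fst f + snd f + s)" for f
  proof -
    obtain i j x y where ij: "f = (i, j)" "c = (x, y)" by (cases f; cases c)
    have "even (i - x + (j - y) + int k)"
      using assms f(2) by (simp add: ij) blast
    then have "odd (\<bar>i - x\<bar> + \<bar>j - y\<bar> + int (Suc k))" by simp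
    moreover have "A \<noteq> B" if "odd (A + B)" for A B :: int using that by auto
    ultimately have "\<bar>i - x\<bar> + \<bar>j - y\<bar> \<noteq> int (Suc k)" by blast
    then show ?thesis using f(1) unfolding ij mem_all_faces mem_internal_faces by simp
  qed
  then show "{f \<in> all_faces (Suc k) c. even (fst f + snd f + s)} = core_faces s (Suc k) c"
    unfolding core_faces_def using all_faces_internal[of "Suc k" c] by blast
qed

lemma prod_parity:
  fixes b :: "face \<Rightarrow> complex"
  assumes "finite A"
  shows "(\<Prod>f\<in>A. b f) = (\<Prod>f\<in>{f \<in> A. even (fst f + snd f + s)}. b f) * (\<Prod>f\<in>{f \<in> A. odd (fst f + snd f + s)}. b f)"
proof -
  have "A = {f \<in> A. even (fst f + snd f + s)} \<union> {f \<in> A. odd (fst f + snd f + s)}" by blast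
  then show ?thesis
    using assms by (metis (mono_tags, lifting) Int_emptyI finite_Un mem_Collect_eq prod.union_disjoint)
qed

text \<open>The step is applied to b and to its inverse. Orientation signs and gauges cancel between
  the two; the remaining numerators, denominators and face weights balance by
  \<open>prod_weights\<close>.\<close>

lemma finite_ratio_Suc:
  assumes par: "even (fst c + snd c + s + int k)" and \<phi>: "kasteleyn (Suc k) c \<phi>"
    and gen: "generic_weights s (Suc k) c b"
  shows "finite_ratio \<phi> (Suc k) c b = finite_ratio \<phi> k c (evolve s b)"
proof -
  let ?F = "core_faces s (Suc k) c" and ?V = "aztec_vertices k c"
  let ?Od = "\<lambda>k. {f \<in> all_faces k c. odd (fst f + snd f + s)}"
  let ?Ib = "\<lambda>f. inverse (b f)"
  have b: "b f \<noteq> 0" if "f \<in> all_faces (Suc k) c" for f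
    using gen that by (simp add: generic_weights_def)
  have F_int: "f \<in> internal_faces (Suc k) c" if "f \<in> ?F" for f
    using that by (simp add: core_faces_def)
  have bF: "b f \<noteq> 0" "\<And>f'. fdist f f' = 1 \<Longrightarrow> b f' \<noteq> 0" if "f \<in> internal_faces (Suc k) c" for f
    using b neighbours_all_faces[OF that] all_faces_internal that by blast+
  have V_sub: "?V \<subseteq> aztec_vertices (Suc k) c"
    unfolding aztec_vertices_def using internal_faces_Suc by blast
  have bV: "b f \<noteq> 0" if "v \<in> aztec_vertices (Suc k) c" "f \<in> vertex_faces (s + 1) v" for v f
    using b vertex_faces_all_faces[OF par that(1)] that(2) by blast
  have gV: "vertex_gauge s b v \<noteq> 0" if "v \<in> aztec_vertices (Suc k) c" for v
    using gen that by (simp add: generic_weights_def)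
  have nd: "at_face dskp_num b f \<noteq> 0" "at_face dskp_den b f \<noteq> 0" if "f \<in> ?F" for f
    using gen that by (simp_all add: generic_weights_def)
  define G O' K Dn Nm Cc P Z1 Z1' Z0 Z0' where "G = (\<Prod>v\<in>?V. vertex_gauge s b v)"
    and "O' = (\<Prod>v\<in>?V. \<Prod>f\<in>vertex_faces (s + 1) v. b f)"
    and "K = (\<Prod>f\<in>?F. of_int (face_sign \<phi> f) :: complex)"
    and "Dn = (\<Prod>f\<in>?F. at_face dskp_den b f)" and "Nm = (\<Prod>f\<in>?F. at_face dskp_num b f)"
    and "Cc = (\<Prod>f\<in>?F. b f)" and "P = (\<Prod>f\<in>?F. \<Prod>f'\<in>{f'. fdist f f' = 1}. b f')"
    and "Z1 = partition_function \<phi> (Suc k) c b" and "Z1' = partition_function \<phi> (Suc k) c ?Ib"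
    and "Z0 = partition_function \<phi> k c (evolve s b)"
    and "Z0' = partition_function \<phi> k c (\<lambda>f. inverse (evolve s b f))"
  have finV: "finite (vertex_faces t v)" for t v by (cases v) simp
  have finN: "finite {f'. fdist f f' = 1}" for f by (cases f) (simp only: fdist_1, simp)
  have prod_ne: "(\<Prod>x\<in>A. h x) \<noteq> 0" if "finite A" "\<And>x. x \<in> A \<Longrightarrow> h x \<noteq> 0"
    for h :: "face \<Rightarrow> complex" and A
    using that by (simp add: prod_zero_iff)
  have prodN: "(\<Prod>f'\<in>{f'. fdist f f' = 1}. b f') \<noteq> 0" if "f \<in> ?F" for f
    using bF(2)[OF F_int[OF that]] by (intro prod_ne finN) blast
  have prodV: "(\<Prod>f\<in>vertex_faces (s + 1) v. b f) \<noteq> 0" if "v \<in> aztec_vertices (Suc k) c" for v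
    using bV[OF that] by (intro prod_ne finV)
  have ne: "G \<noteq> 0" "O' \<noteq> 0" "K \<noteq> 0" "Dn \<noteq> 0" "Nm \<noteq> 0" "Cc \<noteq> 0" "P \<noteq> 0"
    unfolding G_def O'_def K_def Dn_def Nm_def Cc_def P_def
    using face_sign_ne_0[OF \<phi> F_int]
    by (intro prod_ne finite_aztec_vertices finite_core_faces prodN prodV gV nd bF(1) F_int
        subsetD[OF V_sub]; simp del: face_sign.simps)+
  have Z1: "Z1 * G = K * Dn * Z0"
    using partition_function_Suc[OF par \<phi> nd(2) gV, of 1]
    by (simp add: Z1_def G_def K_def Dn_def Z0_def prod.distrib)
  have den': "at_face dskp_den ?Ib f = at_face dskp_num b f / (b f * (\<Prod>f'\<in>{f'. fdist f f' = 1}. b f'))"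
    if "f \<in> ?F" for f
    by (rule at_face_inverse(1)) (use bF F_int that in blast)+
  have den'0: "at_face dskp_den ?Ib f \<noteq> 0" if "f \<in> ?F" for f
    unfolding den'[OF that] using nd(1)[OF that] bF(1)[OF F_int[OF that]] prodN[OF that] by simp
  have gauge': "vertex_gauge s ?Ib v = - vertex_gauge s b v / (\<Prod>f\<in>vertex_faces (s + 1) v. b f)"
    if "v \<in> aztec_vertices (Suc k) c" for v
    by (rule gauge_inverse) (use bV that in blast)
  have gauge'0: "vertex_gauge s ?Ib v \<noteq> 0" if "v \<in> aztec_vertices (Suc k) c" for v
    unfolding gauge'[OF that] using gV[OF that] prodV[OF that] by simp
  have Z0': "partition_function \<phi> k c (evolve s ?Ib) = Z0'"
    unfolding Z0'_def
  proof (rule partition_function_cong)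
    fix f assume "f \<in> all_faces k c"
    then have "f \<in> internal_faces (Suc k) c" using all_faces_Suc by blast
    then show "evolve s ?Ib f = inverse (evolve s b f)"
      using bF by (intro evolve_inverse) blast+
  qed
  have "(\<Prod>v\<in>?V. (-1) * vertex_gauge s ?Ib v) = (\<Prod>v\<in>?V. vertex_gauge s b v / (\<Prod>f\<in>vertex_faces (s + 1) v. b f))"
    using gauge' V_sub by (intro prod.cong) auto
  also have "\<dots> = G / O'" by (simp add: G_def O'_def prod_dividef)
  finally have G': "(\<Prod>v\<in>?V. (-1) * vertex_gauge s ?Ib v) = G / O'" .
  have "(\<Prod>f\<in>?F. of_int (face_sign \<phi> f) * at_face dskp_den ?Ib f) =
      (\<Prod>f\<in>?F. of_int (face_sign \<phi> f) * (at_face dskp_num b f / (b f * (\<Prod>f'\<in>{f'. fdist f f' = 1}. b f'))))"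
    using den' by (intro prod.cong) auto
  also have "\<dots> = K * (Nm / (Cc * P))"
    by (simp add: K_def Nm_def Cc_def P_def prod_dividef prod.distrib)
  finally have Z1': "Z1' * (G / O') = K * (Nm / (Cc * P)) * Z0'"
    using partition_function_Suc[OF par \<phi> den'0 gauge'0, of "-1"] unfolding G' Z0' Z1'_def by simp
  have w: "(\<Prod>f\<in>?Od (Suc k). b f) * O' = P * (\<Prod>f\<in>?Od k. b f)"
    unfolding O'_def P_def by (rule prod_weights[OF par])
  have A1: "(\<Prod>f\<in>all_faces (Suc k) c. b f) = Cc * (\<Prod>f\<in>?Od (Suc k). b f)"
    using prod_parity[OF finite_all_faces, of b "Suc k" c s] core_faces_all_faces(2)[OF par] by (simp add: Cc_def)
  have "(\<Prod>f\<in>all_faces k c. evolve s b f) = (\<Prod>f\<in>?F. evolve s b f) * (\<Prod>f\<in>?Od k. evolve s b f)"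
    using prod_parity[OF finite_all_faces, of "evolve s b" k c s] core_faces_all_faces(1)[OF par] by simp
  also have "(\<Prod>f\<in>?F. evolve s b f) = Nm / Dn"
    unfolding Nm_def Dn_def prod_dividef[symmetric] by (intro prod.cong) (auto simp: evolve_def core_faces_def)
  also have "(\<Prod>f\<in>?Od k. evolve s b f) = (\<Prod>f\<in>?Od k. b f)"
    by (intro prod.cong) (auto simp: evolve_def)
  finally have A0: "(\<Prod>f\<in>all_faces k c. evolve s b f) = Nm / Dn * (\<Prod>f\<in>?Od k. b f)" .
  have Z1_eq: "Z1 = K * Dn * Z0 / G" using Z1 ne by (simp add: field_simps)
  have Z1'_eq: "Z1' = K * Nm * Z0' * O' / (Cc * P * G)" using Z1' ne by (simp add: field_simps)
  have w_eq: "(\<Prod>f\<in>?Od (Suc k). b f) = P * (\<Prod>f\<in>?Od k. b f) / O'" using w ne by (simp add: field_simps)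
  show ?thesis
    unfolding finite_ratio_def A1 A0 w_eq Z1_def[symmetric] Z1'_def[symmetric] Z0_def[symmetric] Z0'_def[symmetric]
    \<comment> \<open>For \<open>Z0 = 0\<close> both ratios are 0 by the convention on
      division.\<close>
    unfolding Z1_eq Z1'_eq using ne by (cases "Z0 = 0") (simp_all add: field_simps)
qed


subsection \<open>Density of generic weights\<close>

text \<open>For weights x^i y^j the neighbours of c are y c, x c, c / y and c / x, whence D = (x +
  1/x - y - 1/y) c^2 and c' = c. The values 2 and 3 avoid x = y and x y = 1, where D and some of the
  gauges vanish; -5/6 is the resulting coefficient.\<close>

fun steady_weight :: "face \<Rightarrow> complex" where
  "steady_weight (i, j) = 2 powi i * 3 powi j"

lemma steady_weight_shift:
  "steady_weight (i + 1, j) = 2 * steady_weight (i, j)" "steady_weight (i, j + 1) = 3 * steady_weight (i, j)"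
  "steady_weight (i - 1, j) = steady_weight (i, j) / 2" "steady_weight (i, j - 1) = steady_weight (i, j) / 3"
  by (simp_all add: power_int_add power_int_diff)

lemma steady_weight_ne_0: "steady_weight f \<noteq> 0"
  by (cases f) simp

lemma at_face_steady:
  "at_face dskp_den steady_weight f = - 5 / 6 * steady_weight f ^ 2"
  "at_face dskp_num steady_weight f = - 5 / 6 * steady_weight f ^ 3"
proof -
  obtain i j where f: "f = (i, j)" by (cases f)
  show "at_face dskp_den steady_weight f = - 5 / 6 * steady_weight f ^ 2"
    unfolding f at_face.simps steady_weight_shift dskp_den_def
    by (simp add: power2_eq_square field_simps del: steady_weight.simps)
  show "at_face dskp_num steady_weight f = - 5 / 6 * steady_weight f ^ 3"
    unfolding f at_face.simps steady_weight_shift dskp_num_def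
    by (simp add: power3_eq_cube field_simps del: steady_weight.simps)
qed

lemma evolve_steady: "evolve s steady_weight = steady_weight"
proof
  fix f
  show "evolve s steady_weight f = steady_weight f"
    using steady_weight_ne_0[of f] unfolding evolve_def at_face_steady
    by (simp add: power2_eq_square power3_eq_cube)
qed

lemma gauge_steady: "vertex_gauge s steady_weight v \<noteq> 0"
proof -
  obtain p q where v: "v = (p, q)" by (cases v)
  have "steady_weight (p + 1, q + 1) = 6 * steady_weight (p, q)"
    using steady_weight_shift(1)[of p "q + 1"] steady_weight_shift(2)[of p q] by simp
  then show ?thesis
    using steady_weight_ne_0[of "(p, q)"]
    unfolding v by (simp add: steady_weight_shift del: steady_weight.simps)
qed

lemma generic_steady: "generic_weights s k c steady_weight"
  unfolding generic_weights_def at_face_steady using steady_weight_ne_0 gauge_steady by simp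

text \<open>Stationarity lets the time step be iterated on the same weights, and every factor it
  produces is nonzero.\<close>

lemma partition_function_steady: "kasteleyn k c \<phi> \<Longrightarrow> partition_function \<phi> k c steady_weight \<noteq> 0"
proof (induction k)
  case 0
  have "aztec_darts 0 c = {}" "aztec_vertices 0 c = {}"
    by (cases c; auto simp: aztec_darts_def aztec_vertices_def internal_faces_def)+
  then show ?case
    by (simp add: partition_function_matching_sum matching_sum_empty)
next
  case (Suc k)
  define s where "s = - (fst c + snd c + int k)"
  have par: "even (fst c + snd c + s + int k)" by (simp add: s_def)
  have F: "of_int (face_sign \<phi> f) * at_face dskp_den steady_weight f \<noteq> 0" if "f \<in> core_faces s (Suc k) c" for f
    using that face_sign_ne_0[OF Suc.prems, of f] steady_weight_ne_0[of f]
    by (simp add: at_face_steady core_faces_def)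
  have "partition_function \<phi> (Suc k) c steady_weight * (\<Prod>v\<in>aztec_vertices k c. 1 * vertex_gauge s steady_weight v) =
      (\<Prod>f\<in>core_faces s (Suc k) c. of_int (face_sign \<phi> f) * at_face dskp_den steady_weight f) *
      partition_function \<phi> k c (evolve s steady_weight)"
    by (rule partition_function_Suc[OF par Suc.prems])
       (simp_all add: at_face_steady steady_weight_ne_0 gauge_steady del: vertex_gauge.simps)
  moreover have "(\<Prod>f\<in>core_faces s (Suc k) c. of_int (face_sign \<phi> f) * at_face dskp_den steady_weight f) \<noteq> 0"
    unfolding prod_zero_iff[OF finite_core_faces] using F by blast
  ultimately show ?case
    using Suc.IH[OF kasteleyn_Suc[OF Suc.prems]] unfolding evolve_steady by auto
qed

section \<open>Nonvanishing of polynomials along a complex line\<close>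

definition is_poly :: "(complex \<Rightarrow> complex) \<Rightarrow> bool" where
  "is_poly h \<longleftrightarrow> (\<exists>p. \<forall>t. h t = poly p t)"

lemma is_poly_const: "is_poly (\<lambda>t. a)"
  unfolding is_poly_def by (rule exI[of _ "[:a:]"]) simp

lemma is_poly_id: "is_poly (\<lambda>t. t)"
  unfolding is_poly_def by (rule exI[of _ "[:0, 1:]"]) simp

lemma is_poly_add: "is_poly g \<Longrightarrow> is_poly h \<Longrightarrow> is_poly (\<lambda>t. g t + h t)"
  unfolding is_poly_def by (metis poly_add)

lemma is_poly_diff: "is_poly g \<Longrightarrow> is_poly h \<Longrightarrow> is_poly (\<lambda>t. g t - h t)"
  unfolding is_poly_def by (metis poly_diff)

lemma is_poly_mult: "is_poly g \<Longrightarrow> is_poly h \<Longrightarrow> is_poly (\<lambda>t. g t * h t)"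
  unfolding is_poly_def by (metis poly_mult)

lemma is_poly_sum: "(\<And>x. x \<in> A \<Longrightarrow> is_poly (h x)) \<Longrightarrow> is_poly (\<lambda>t. \<Sum>x\<in>A. h x t)"
  by (induction A rule: infinite_finite_induct) (simp_all add: is_poly_const is_poly_add)

lemma is_poly_prod: "(\<And>x. x \<in> A \<Longrightarrow> is_poly (h x)) \<Longrightarrow> is_poly (\<lambda>t. \<Prod>x\<in>A. h x t)"
  by (induction A rule: infinite_finite_induct) (simp_all add: is_poly_const is_poly_mult)

lemma is_poly_if: "is_poly g \<Longrightarrow> is_poly h \<Longrightarrow> is_poly (\<lambda>t. if P then g t else h t)"
  by (cases P) simp_all

lemmas is_poly_intros = is_poly_const is_poly_id is_poly_add is_poly_diff is_poly_mult is_poly_sum is_poly_prod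

lemma is_poly_eventually_ne_0:
  assumes "is_poly h" "h a \<noteq> 0"
  shows "eventually (\<lambda>t. h t \<noteq> 0) (at b)"
proof -
  obtain p where p: "\<And>t. h t = poly p t" using assms(1) by (auto simp: is_poly_def)
  have "p \<noteq> 0" using assms(2) p by auto
  then have "finite {t. poly p t = 0}" by (rule poly_roots_finite)
  then have "eventually (\<lambda>t. t \<notin> {t. poly p t = 0}) (at b)"
    using islimpt_finite islimpt_iff_eventually by blast
  then show ?thesis by (simp add: p)
qed

text \<open>The complex line through b at t = 0 and the stationary weights at t = 1. A polynomial
  that is nonzero at t = 1 has finitely many zeros, hence none near 0 except possibly 0
  itself.\<close>

definition path_to_steady :: "(face \<Rightarrow> complex) \<Rightarrow> complex \<Rightarrow> face \<Rightarrow> complex" where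
  "path_to_steady b t f = (1 - t) * b f + t * steady_weight f"

lemma path_1: "path_to_steady b 1 = steady_weight"
  by (simp add: path_to_steady_def fun_eq_iff)

lemma is_poly_path: "is_poly (\<lambda>t. path_to_steady b t f)"
  unfolding path_to_steady_def by (intro is_poly_intros)

lemma tendsto_path: "((\<lambda>t. path_to_steady b t f) \<longlongrightarrow> b f) (at 0)"
proof -
  have "((\<lambda>t. path_to_steady b t f) \<longlongrightarrow> (1 - 0) * b f + 0 * steady_weight f) (at 0)"
    unfolding path_to_steady_def by (intro tendsto_intros)
  then show ?thesis by simp
qed

lemma path_generic:
  assumes "kasteleyn k c \<phi>"
  shows "eventually (\<lambda>t. generic_weights s k c (path_to_steady b t) \<and>
    partition_function \<phi> k c (path_to_steady b t) \<noteq> 0) (at 0)"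
proof -
  let ?b = "path_to_steady b"
  have gen: "generic_weights s k c (?b 1)" by (simp add: path_1 generic_steady)
  have at: "is_poly (\<lambda>t. at_face dskp_num (?b t) f)" "is_poly (\<lambda>t. at_face dskp_den (?b t) f)" for f
    by (cases f; simp add: dskp_num_def dskp_den_def; intro is_poly_intros is_poly_path)+
  have g: "is_poly (\<lambda>t. vertex_gauge s (?b t) v)" for v
  proof -
    obtain p q where v: "v = (p, q)" by (cases v)
    show ?thesis unfolding v vertex_gauge.simps by (intro is_poly_intros is_poly_path is_poly_if)
  qed
  have Z: "is_poly (\<lambda>t. partition_function \<phi> k c (?b t))"
    unfolding partition_function_def by (intro is_poly_intros is_poly_path)
  have "eventually (\<lambda>t. \<forall>f\<in>all_faces k c. ?b t f \<noteq> 0) (at 0)"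
    using gen by (intro eventually_ball_finite[OF finite_all_faces] ballI is_poly_eventually_ne_0[OF is_poly_path, where a = 1])
      (simp add: generic_weights_def)
  moreover have "eventually (\<lambda>t. \<forall>v\<in>aztec_vertices k c. vertex_gauge s (?b t) v \<noteq> 0) (at 0)"
    using gen by (intro eventually_ball_finite[OF finite_aztec_vertices] ballI is_poly_eventually_ne_0[OF g, where a = 1])
      (simp add: generic_weights_def)
  moreover have "eventually (\<lambda>t. \<forall>f\<in>core_faces s k c. at_face dskp_num (?b t) f \<noteq> 0) (at 0)"
    using gen by (intro eventually_ball_finite[OF finite_core_faces] ballI is_poly_eventually_ne_0[OF at(1), where a = 1])
      (simp add: generic_weights_def)
  moreover have "eventually (\<lambda>t. \<forall>f\<in>core_faces s k c. at_face dskp_den (?b t) f \<noteq> 0) (at 0)"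
    using gen by (intro eventually_ball_finite[OF finite_core_faces] ballI is_poly_eventually_ne_0[OF at(2), where a = 1])
      (simp add: generic_weights_def)
  moreover have "eventually (\<lambda>t. partition_function \<phi> k c (?b t) \<noteq> 0) (at 0)"
    using partition_function_steady[OF assms] by (intro is_poly_eventually_ne_0[OF Z, where a = 1]) (simp add: path_1)
  ultimately show ?thesis
    unfolding generic_weights_def by eventually_elim blast
qed

lemma path_near:
  assumes "finite A" "0 < \<epsilon>"
  shows "eventually (\<lambda>t. \<forall>f\<in>A. dist (path_to_steady b t f) (b f) < \<epsilon>) (at 0)"
  by (intro eventually_ball_finite assms ballI tendstoD[OF tendsto_path])

lemma admissible_approx:
  assumes "kasteleyn k c \<phi>" "0 < \<epsilon>"
  obtains b' where "admissible_weights \<phi> k c b'" "\<And>f. f \<in> all_faces k c \<Longrightarrow> dist (b' f) (b f) < \<epsilon>"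
proof -
  have "eventually (\<lambda>t. admissible_weights \<phi> k c (path_to_steady b t) \<and>
      (\<forall>f\<in>all_faces k c. dist (path_to_steady b t f) (b f) < \<epsilon>)) (at 0)"
    using path_generic[OF assms(1), of 0 b] path_near[OF finite_all_faces assms(2), of k c b]
    by eventually_elim (simp add: admissible_weights_def generic_weights_def)
  then have "\<exists>t. admissible_weights \<phi> k c (path_to_steady b t) \<and>
      (\<forall>f\<in>all_faces k c. dist (path_to_steady b t f) (b f) < \<epsilon>)"
    by (rule eventually_happens'[rotated]) simp
  then show thesis using that by blast
qed

text \<open>The finite ratio is continuous where the partition function does not vanish, so it stays
  close along with the weights.\<close>

lemma generic_approx:
  assumes "kasteleyn k c \<phi>" and adm: "admissible_weights \<phi> k c b" and "0 < \<epsilon>"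
  obtains b' where "generic_weights s k c b'" "partition_function \<phi> k c b' \<noteq> 0"
    "\<And>f. f \<in> all_faces k c \<Longrightarrow> dist (b' f) (b f) < \<epsilon>"
    "dist (finite_ratio \<phi> k c b') (finite_ratio \<phi> k c b) < \<epsilon>"
proof -
  let ?b = "path_to_steady b"
  have Z: "((\<lambda>t. partition_function \<phi> k c (g t)) \<longlongrightarrow> partition_function \<phi> k c d) (at 0)"
    if "\<And>f. f \<in> all_faces k c \<Longrightarrow> ((\<lambda>t. g t f) \<longlongrightarrow> d f) (at 0)" for g :: "complex \<Rightarrow> face \<Rightarrow> complex" and d
    unfolding partition_function_def
    by (intro tendsto_intros that right_face_in_all_faces) (auto simp: oriented_dimers_def)
  have "((\<lambda>t. finite_ratio \<phi> k c (?b t)) \<longlongrightarrow> finite_ratio \<phi> k c b) (at 0)"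
    unfolding finite_ratio_def using adm
    by (intro tendsto_intros Z tendsto_path) (auto simp: admissible_weights_def)
  then have "eventually (\<lambda>t. dist (finite_ratio \<phi> k c (?b t)) (finite_ratio \<phi> k c b) < \<epsilon>) (at 0)"
    using assms(3) by (rule tendstoD)
  then have "eventually (\<lambda>t. generic_weights s k c (?b t) \<and> partition_function \<phi> k c (?b t) \<noteq> 0 \<and>
      (\<forall>f\<in>all_faces k c. dist (?b t f) (b f) < \<epsilon>) \<and>
      dist (finite_ratio \<phi> k c (?b t)) (finite_ratio \<phi> k c b) < \<epsilon>) (at 0)"
    using path_generic[OF assms(1), of s b] path_near[OF finite_all_faces assms(3), of k c b]
    by eventually_elim simp
  then have "\<exists>t. generic_weights s k c (?b t) \<and> partition_function \<phi> k c (?b t) \<noteq> 0 \<and>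
      (\<forall>f\<in>all_faces k c. dist (?b t f) (b f) < \<epsilon>) \<and>
      dist (finite_ratio \<phi> k c (?b t)) (finite_ratio \<phi> k c b) < \<epsilon>"
    by (rule eventually_happens'[rotated]) simp
  then show thesis using that by blast
qed


subsection \<open>Limits on the Riemann sphere\<close>

lemma limitin_sphere_None:
  "limitin sphere_top (\<lambda>n. Some (x n)) None F \<longleftrightarrow> filterlim x at_infinity F"
proof
  assume L: "limitin sphere_top (\<lambda>n. Some (x n)) None F"
  show "filterlim x at_infinity F"
    unfolding filterlim_at_infinity[OF order_refl]
  proof (intro allI impI)
    fix r :: real
    have "openin sphere_top (insert None (Some ` (topspace euclidean - cball 0 r)))"
      unfolding sphere_top_def openin_Alexandroff_compactification
      by (intro disjI2 exI[of _ "cball 0 r"]) simp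
    then have "eventually (\<lambda>n. Some (x n) \<in> insert None (Some ` (topspace euclidean - cball 0 r))) F"
      using limitinD[OF L] by blast
    then show "eventually (\<lambda>n. r \<le> norm (x n)) F"
      by eventually_elim auto
  qed
next
  assume x: "filterlim x at_infinity F"
  show "limitin sphere_top (\<lambda>n. Some (x n)) None F"
    unfolding limitin_def
  proof (intro conjI allI impI)
    fix U assume U: "openin sphere_top U \<and> None \<in> U"
    then obtain C where C: "compact C" "U = insert None (Some ` (UNIV - C))"
      unfolding sphere_top_def openin_Alexandroff_compactification by auto
    then obtain r where r: "C \<subseteq> ball 0 r" "0 < r"
      using bounded_subset_ballD[OF compact_imp_bounded] by blast
    have "eventually (\<lambda>n. r \<le> norm (x n)) F"
      using x r(2) unfolding filterlim_at_infinity[OF order_refl] by blast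
    then show "eventually (\<lambda>n. Some (x n) \<in> U) F"
      by eventually_elim (use r C in fastforce)
  qed simp
qed

text \<open>The distance is Euclidean even when the limit is infinite: a vanishing displacement does
  not affect divergence to infinity.\<close>

lemma limitin_sphere_perturb:
  assumes "limitin sphere_top (\<lambda>n. Some (x n)) y F" and "((\<lambda>n. dist (x' n) (x n)) \<longlongrightarrow> 0) F"
  shows "limitin sphere_top (\<lambda>n. Some (x' n)) y F"
proof -
  have d: "((\<lambda>n. x' n - x n) \<longlongrightarrow> 0) F"
    using assms(2) by (simp add: dist_norm tendsto_norm_zero_iff)
  show ?thesis
  proof (cases y)
    case None
    then have "filterlim x at_infinity F" using assms(1) by (simp add: limitin_sphere_None)
    then have "filterlim (\<lambda>n. (x' n - x n) + x n) at_infinity F"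
      by (rule tendsto_add_filterlim_at_infinity[OF d])
    then show ?thesis by (simp add: None limitin_sphere_None)
  next
    case (Some l)
    then have "(x \<longlongrightarrow> l) F" using assms(1) by (simp add: limitin_sphere_Some)
    then have "((\<lambda>n. (x' n - x n) + x n) \<longlongrightarrow> 0 + l) F"
      by (intro tendsto_add d)
    then show ?thesis by (simp add: Some limitin_sphere_Some)
  qed
qed

text \<open>Convergence on the sphere in homogeneous coordinates; the scaling factors may vanish.\<close>

lemma limitin_sphere_hcoordD:
  assumes "limitin sphere_top (\<lambda>n. Some (x n)) y F"
  obtains \<mu> where "((\<lambda>n. \<mu> n * x n) \<longlongrightarrow> fst (hcoord y)) F" "(\<mu> \<longlongrightarrow> snd (hcoord y)) F"
proof (cases y)
  case None
  then have x: "filterlim x at_infinity F" using assms by (simp add: limitin_sphere_None)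
  have "eventually (\<lambda>n. 1 \<le> norm (x n)) F"
    using x unfolding filterlim_at_infinity[OF order_refl] by simp
  then have "eventually (\<lambda>n. inverse (x n) * x n = 1) F"
    by eventually_elim (rule left_inverse, auto)
  then have "((\<lambda>n. inverse (x n) * x n) \<longlongrightarrow> 1) F"
    by (rule tendsto_eventually)
  moreover have "((\<lambda>n. inverse (x n)) \<longlongrightarrow> 0) F"
    using x by (rule filterlim_compose[OF tendsto_inverse_0])
  ultimately show thesis using that None by simp
next
  case (Some l)
  then have "(x \<longlongrightarrow> l) F" using assms by (simp add: limitin_sphere_Some)
  then show thesis using that[of "\<lambda>_. 1"] Some by simp
qed

lemma limitin_sphere_hcoordI:
  assumes "((\<lambda>n. \<mu> n * x n) \<longlongrightarrow> r * fst (hcoord y)) F" "(\<mu> \<longlongrightarrow> r * snd (hcoord y)) F" "r \<noteq> 0"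
  shows "limitin sphere_top (\<lambda>n. Some (x n)) y F"
proof (cases y)
  case None
  have lim: "((\<lambda>n. \<mu> n * x n) \<longlongrightarrow> r) F" "(\<mu> \<longlongrightarrow> 0) F" using assms None by simp_all
  have "eventually (\<lambda>n. \<mu> n * x n \<noteq> 0) F"
    using lim(1) assms(3) by (rule tendsto_imp_eventually_ne)
  then have ne: "eventually (\<lambda>n. \<mu> n \<noteq> 0) F"
    by eventually_elim auto
  then have "filterlim \<mu> (at 0) F"
    using lim(2) by (simp add: filterlim_at)
  then have "filterlim (\<lambda>n. inverse (\<mu> n)) at_infinity F"
    by (rule filterlim_compose[OF filterlim_inverse_at_infinity])
  then have "filterlim (\<lambda>n. (\<mu> n * x n) / \<mu> n) at_infinity F"
    unfolding divide_inverse by (rule tendsto_mult_filterlim_at_infinity[OF lim(1) assms(3)])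
  moreover have "eventually (\<lambda>n. (\<mu> n * x n) / \<mu> n = x n) F"
    using ne by eventually_elim simp
  ultimately have "filterlim x at_infinity F"
    using filterlim_cong[OF refl refl, of "\<lambda>n. (\<mu> n * x n) / \<mu> n" x F at_infinity] by simp
  then show ?thesis by (simp add: None limitin_sphere_None)
next
  case (Some l)
  have lim: "((\<lambda>n. \<mu> n * x n) \<longlongrightarrow> r * l) F" "(\<mu> \<longlongrightarrow> r) F" using assms Some by simp_all
  have ne: "eventually (\<lambda>n. \<mu> n \<noteq> 0) F"
    using lim(2) assms(3) by (rule tendsto_imp_eventually_ne)
  have "((\<lambda>n. (\<mu> n * x n) / \<mu> n) \<longlongrightarrow> (r * l) / r) F"
    by (intro tendsto_divide lim assms(3))
  moreover have "eventually (\<lambda>n. (\<mu> n * x n) / \<mu> n = x n) F"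
    using ne by eventually_elim simp
  ultimately have "(x \<longlongrightarrow> (r * l) / r) F"
    by (rule Lim_transform_eventually)
  then show ?thesis using assms(3) by (simp add: Some limitin_sphere_Some)
qed

section \<open>The dSKP equation on the sphere and limits of the ratio function\<close>

lemma hdiff_commute: "hdiff b a = - hdiff a b"
  by (simp add: hdiff_def)

lemma hdiff_eq_0_iff: "hdiff a b = 0 \<longleftrightarrow> a = b"
  by (cases a; cases b) (auto simp: hdiff_def)

text \<open>The multi-ratio of the hexagon e, n, c, w, s, c' is -1; the inequations ensure that this
  determines c', continuously in the other five points.\<close>

definition sphere_dskp :: "sphere \<Rightarrow> sphere \<Rightarrow> sphere \<Rightarrow> sphere \<Rightarrow> sphere \<Rightarrow> sphere \<Rightarrow> bool" where
  "sphere_dskp c n e s w c' \<longleftrightarrow>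
     hdiff e n * hdiff c w * hdiff s c' = hdiff n c * hdiff w s * hdiff e c' \<and>
     e \<noteq> n \<and> c \<noteq> w \<and> e \<noteq> s"

text \<open>Scaled by the product of the five homogeneous factors, the vector (numerator,
  denominator) is a combination of the vectors of s and e with convergent coefficients. Its limit is
  parallel to the vector of c' by the multi-ratio equation, and nonzero by the inequations.\<close>

lemma limitin_dskp:
  assumes c: "limitin sphere_top (\<lambda>i. Some (c i)) C F" and n: "limitin sphere_top (\<lambda>i. Some (n i)) N F"
    and e: "limitin sphere_top (\<lambda>i. Some (e i)) E F" and s: "limitin sphere_top (\<lambda>i. Some (s i)) S F"
    and w: "limitin sphere_top (\<lambda>i. Some (w i)) W F"
    and dskp: "sphere_dskp C N E S W C'"
    and den: "\<And>i. dskp_den (c i) (n i) (e i) (s i) (w i) \<noteq> 0"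
  shows "limitin sphere_top
    (\<lambda>i. Some (dskp_num (c i) (n i) (e i) (s i) (w i) / dskp_den (c i) (n i) (e i) (s i) (w i))) C' F"
proof -
  obtain \<mu>c where \<mu>c: "((\<lambda>i. \<mu>c i * c i) \<longlongrightarrow> fst (hcoord C)) F" "(\<mu>c \<longlongrightarrow> snd (hcoord C)) F"
    using limitin_sphere_hcoordD[OF c] .
  obtain \<mu>n where \<mu>n: "((\<lambda>i. \<mu>n i * n i) \<longlongrightarrow> fst (hcoord N)) F" "(\<mu>n \<longlongrightarrow> snd (hcoord N)) F"
    using limitin_sphere_hcoordD[OF n] .
  obtain \<mu>e where \<mu>e: "((\<lambda>i. \<mu>e i * e i) \<longlongrightarrow> fst (hcoord E)) F" "(\<mu>e \<longlongrightarrow> snd (hcoord E)) F"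
    using limitin_sphere_hcoordD[OF e] .
  obtain \<mu>s where \<mu>s: "((\<lambda>i. \<mu>s i * s i) \<longlongrightarrow> fst (hcoord S)) F" "(\<mu>s \<longlongrightarrow> snd (hcoord S)) F"
    using limitin_sphere_hcoordD[OF s] .
  obtain \<mu>w where \<mu>w: "((\<lambda>i. \<mu>w i * w i) \<longlongrightarrow> fst (hcoord W)) F" "(\<mu>w \<longlongrightarrow> snd (hcoord W)) F"
    using limitin_sphere_hcoordD[OF w] .
  define \<mu> where "\<mu> i = \<mu>c i * \<mu>n i * \<mu>e i * \<mu>s i * \<mu>w i" for i
  define A where "A cp cq np nq ep eq wp wq = (ep * nq - np * eq) * (cp * wq - wp * cq)"
    for cp cq np nq ep eq wp wq :: complex
  define B where "B cp cq np nq sp sq wp wq = (np * cq - cp * nq) * (wp * sq - sp * wq)"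
    for cp cq np nq sp sq wp wq :: complex
  define a where "a i = A (\<mu>c i * c i) (\<mu>c i) (\<mu>n i * n i) (\<mu>n i) (\<mu>e i * e i) (\<mu>e i) (\<mu>w i * w i) (\<mu>w i)" for i
  define b where "b i = B (\<mu>c i * c i) (\<mu>c i) (\<mu>n i * n i) (\<mu>n i) (\<mu>s i * s i) (\<mu>s i) (\<mu>w i * w i) (\<mu>w i)" for i
  have num: "\<mu> i * dskp_num (c i) (n i) (e i) (s i) (w i) = a i * (\<mu>s i * s i) - b i * (\<mu>e i * e i)" for i
    unfolding \<mu>_def a_def b_def A_def B_def dskp_num_def by algebra
  have den': "\<mu> i * dskp_den (c i) (n i) (e i) (s i) (w i) = a i * \<mu>s i - b i * \<mu>e i" for i
    unfolding \<mu>_def a_def b_def A_def B_def dskp_den_def by algebra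
  define A' B' where "A' = hdiff E N * hdiff C W" and "B' = hdiff N C * hdiff W S"
  have a: "(a \<longlongrightarrow> A') F"
    unfolding a_def A_def A'_def hdiff_def by (intro tendsto_intros \<mu>c \<mu>n \<mu>e \<mu>s \<mu>w)
  have b: "(b \<longlongrightarrow> B') F"
    unfolding b_def B_def B'_def hdiff_def by (intro tendsto_intros \<mu>c \<mu>n \<mu>e \<mu>s \<mu>w)
  have eq: "A' * hdiff S C' = B' * hdiff E C'" and A': "A' \<noteq> 0" and ES: "hdiff E S \<noteq> 0"
    using dskp unfolding sphere_dskp_def A'_def B'_def by (auto simp: hdiff_eq_0_iff)
  define p q where "p = A' * fst (hcoord S) - B' * fst (hcoord E)" and "q = A' * snd (hcoord S) - B' * snd (hcoord E)"
  have "\<exists>r. r \<noteq> 0 \<and> p = r * fst (hcoord C') \<and> q = r * snd (hcoord C')"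
  proof -
    have par: "p * snd (hcoord C') = q * fst (hcoord C')"
      using eq unfolding p_def q_def hdiff_def by (simp add: algebra_simps)
    \<comment> \<open>In the determinant with the vector of \<open>E\<close> the second term of (p,
      q) drops out.\<close>
    have "fst (hcoord E) * q - p * snd (hcoord E) = A' * hdiff E S"
      unfolding p_def q_def hdiff_def by (simp add: algebra_simps)
    then have "p \<noteq> 0 \<or> q \<noteq> 0" using A' ES by auto
    then show ?thesis
      using par by (cases C') auto
  qed
  then obtain r where r: "r \<noteq> 0" "p = r * fst (hcoord C')" "q = r * snd (hcoord C')" by blast
  show ?thesis
  proof (rule limitin_sphere_hcoordI[OF _ _ r(1)])
    let ?d = "\<lambda>i. \<mu> i * dskp_den (c i) (n i) (e i) (s i) (w i)"
    have "?d i * (dskp_num (c i) (n i) (e i) (s i) (w i) / dskp_den (c i) (n i) (e i) (s i) (w i)) =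
        a i * (\<mu>s i * s i) - b i * (\<mu>e i * e i)" for i
      using den[of i] num[of i] by simp
    moreover have "((\<lambda>i. a i * (\<mu>s i * s i) - b i * (\<mu>e i * e i)) \<longlongrightarrow> p) F"
      unfolding p_def by (intro tendsto_intros a b \<mu>s \<mu>e)
    ultimately show "((\<lambda>i. ?d i * (dskp_num (c i) (n i) (e i) (s i) (w i) / dskp_den (c i) (n i) (e i) (s i) (w i)))
        \<longlongrightarrow> r * fst (hcoord C')) F"
      by (simp add: r)
    show "(?d \<longlongrightarrow> r * snd (hcoord C')) F"
      unfolding den' r(3)[symmetric] q_def by (intro tendsto_intros a b \<mu>s \<mu>e)
  qed
qed

text \<open>A time step lowers k and raises s by one, which leaves the final time s + k + 1
  unchanged. The claim covers all admissible sequences, so the evolved sequence can be fed into the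
  induction hypothesis.\<close>

lemma limit_finite_ratio:
  fixes x :: "int \<Rightarrow> face \<Rightarrow> sphere"
  assumes x: "\<And>t i j. even (i + j + t) \<Longrightarrow>
      sphere_dskp (x t (i, j)) (x (t + 1) (i, j + 1)) (x (t + 1) (i + 1, j))
        (x (t + 1) (i, j - 1)) (x (t + 1) (i - 1, j)) (x (t + 2) (i, j))"
    and "kasteleyn k c \<phi>" and "even (fst c + snd c + s + int k + 1)"
    and "\<And>n. admissible_weights \<phi> k c (b n)"
    and "\<And>f. f \<in> all_faces k c \<Longrightarrow>
      limitin sphere_top (\<lambda>n. Some (b n f)) (x (s + (fst f + snd f + s) mod 2) f) sequentially"
  shows "limitin sphere_top (\<lambda>n. Some (finite_ratio \<phi> k c (b n))) (x (s + int k + 1) c) sequentially"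
  using assms(2-)
proof (induction k arbitrary: s b)
  case 0
  have [simp]: "all_faces 0 c = {c}" "aztec_darts 0 c = {}" "aztec_vertices 0 c = {}"
    by (cases c; auto simp: all_faces_def internal_faces_def open_faces_def aztec_darts_def
        aztec_vertices_def)+
  \<comment> \<open>By parity the only face carries the value of time s + 1.\<close>
  have "(fst c + snd c + s) mod 2 = 1" using 0 by simp presburger
  then have "limitin sphere_top (\<lambda>n. Some (b n c)) (x (s + 1) c) sequentially"
    using 0(4)[of c] by simp
  then show ?case
    by (simp add: finite_ratio_def partition_function_def oriented_dimers_def)
next
  case (Suc k)
  have par: "even (fst c + snd c + s + int k)" using Suc.prems(2) unfolding of_nat_Suc by presburger
  \<comment> \<open>The given weights need not admit the time step; they are replaced by generic
    ones within a positive bound that tends to 0.\<close>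
  have "\<exists>b'. generic_weights s (Suc k) c b' \<and> partition_function \<phi> (Suc k) c b' \<noteq> 0 \<and>
      (\<forall>f\<in>all_faces (Suc k) c. dist (b' f) (b n f) < 1 / real (Suc n)) \<and>
      dist (finite_ratio \<phi> (Suc k) c b') (finite_ratio \<phi> (Suc k) c (b n)) < 1 / real (Suc n)" for n
    by (rule generic_approx[OF Suc.prems(1) Suc.prems(3)[of n], of "1 / real (Suc n)" s]) (simp, blast)
  then obtain b' where gen: "\<And>n. generic_weights s (Suc k) c (b' n)"
    and Z: "\<And>n. partition_function \<phi> (Suc k) c (b' n) \<noteq> 0"
    and near: "\<And>n f. f \<in> all_faces (Suc k) c \<Longrightarrow> dist (b' n f) (b n f) < 1 / real (Suc n)"
    and near': "\<And>n. dist (finite_ratio \<phi> (Suc k) c (b' n)) (finite_ratio \<phi> (Suc k) c (b n)) < 1 / real (Suc n)"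
    by metis
  have null: "(\<lambda>n. dist (u n) (v n)) \<longlonglongrightarrow> 0" if "\<And>n. dist (u n) (v n) < 1 / real (Suc n)"
    for u v :: "nat \<Rightarrow> complex"
    by (rule tendsto_sandwich[OF _ _ tendsto_const LIMSEQ_Suc[OF lim_1_over_n]])
      (use that in \<open>auto intro!: always_eventually less_imp_le\<close>)
  have lim: "limitin sphere_top (\<lambda>n. Some (b' n f)) (x (s + (fst f + snd f + s) mod 2) f) sequentially"
    if "f \<in> all_faces (Suc k) c" for f
    by (rule limitin_sphere_perturb[OF Suc.prems(4)[OF that] null[OF near[OF that]]])
  have "limitin sphere_top (\<lambda>n. Some (finite_ratio \<phi> k c (evolve s (b' n)))) (x ((s + 1) + int k + 1) c) sequentially"
  proof (rule Suc.IH)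
    show "kasteleyn k c \<phi>" by (rule kasteleyn_Suc) fact
    show "even (fst c + snd c + (s + 1) + int k + 1)" using par by presburger
  next
    fix n
    have den: "at_face dskp_den (b' n) f \<noteq> 0" if "f \<in> core_faces s (Suc k) c" for f
      using gen[of n] that by (simp add: generic_weights_def)
    have gauge: "vertex_gauge s (b' n) v \<noteq> 0" if "v \<in> aztec_vertices (Suc k) c" for v
      using gen[of n] that by (simp add: generic_weights_def)
    have "(\<Prod>v\<in>aztec_vertices k c. 1 * vertex_gauge s (b' n) v) \<noteq> 0"
      unfolding prod_zero_iff[OF finite_aztec_vertices]
      using gauge internal_faces_Suc[of k c] unfolding aztec_vertices_def by auto
    then have "partition_function \<phi> k c (evolve s (b' n)) \<noteq> 0"
      using partition_function_Suc[OF par Suc.prems(1) den gauge, of 1] Z[of n] by auto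
    moreover have "evolve s (b' n) f \<noteq> 0" if "f \<in> all_faces k c" for f
    proof (cases "even (fst f + snd f + s)")
      case True
      then have "f \<in> core_faces s (Suc k) c" using that core_faces_all_faces(1)[OF par] by blast
      then show ?thesis using gen[of n] True by (simp add: generic_weights_def evolve_def)
    next
      case False
      have "f \<in> all_faces (Suc k) c" using that all_faces_Suc all_faces_internal by blast
      then show ?thesis using gen[of n] False by (simp add: generic_weights_def evolve_def)
    qed
    ultimately show "admissible_weights \<phi> k c (evolve s (b' n))"
      by (simp add: admissible_weights_def)
  next
    fix f assume f: "f \<in> all_faces k c"
    then have f': "f \<in> internal_faces (Suc k) c" "f \<in> all_faces (Suc k) c"
      using all_faces_Suc all_faces_internal by blast+
    obtain i j where ij: "f = (i, j)" by (cases f)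
    show "limitin sphere_top (\<lambda>n. Some (evolve s (b' n) f))
        (x (s + 1 + (fst f + snd f + (s + 1)) mod 2) f) sequentially"
    \<comment> \<open>An evolving face passes from time s to s + 2, any other keeps its value of
      time s + 1. These are the values prescribed for start time s + 1.\<close>
    proof (cases "even (i + j + s)")
      case True
      have nb: "f' \<in> all_faces (Suc k) c" if "fdist f f' = 1" for f'
        using neighbours_all_faces[OF f'(1)] that by blast
      have den: "dskp_den (b' n (i, j)) (b' n (i, j + 1)) (b' n (i + 1, j)) (b' n (i, j - 1)) (b' n (i - 1, j)) \<noteq> 0" for n
      proof -
        have "f \<in> core_faces s (Suc k) c" using f'(1) True by (simp add: core_faces_def ij)
        then have "at_face dskp_den (b' n) f \<noteq> 0" using gen[of n] by (simp add: generic_weights_def)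
        then show ?thesis by (simp add: ij)
      qed
      have m: "(i + j + s) mod 2 = 0" "(i + (j + 1) + s) mod 2 = 1" "(i + 1 + j + s) mod 2 = 1"
        "(i + (j - 1) + s) mod 2 = 1" "(i - 1 + j + s) mod 2 = 1" "(i + j + (s + 1)) mod 2 = 1"
        using True by presburger+
      have "limitin sphere_top (\<lambda>n. Some (dskp_num (b' n (i, j)) (b' n (i, j + 1)) (b' n (i + 1, j)) (b' n (i, j - 1)) (b' n (i - 1, j))
          / dskp_den (b' n (i, j)) (b' n (i, j + 1)) (b' n (i + 1, j)) (b' n (i, j - 1)) (b' n (i - 1, j))))
          (x (s + 2) (i, j)) sequentially"
        by (rule limitin_dskp[OF _ _ _ _ _ x[OF True] den])
          (use lim[OF f'(2)] lim[OF nb, of "(i, j + 1)"] lim[OF nb, of "(i + 1, j)"]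
            lim[OF nb, of "(i, j - 1)"] lim[OF nb, of "(i - 1, j)"] in \<open>simp_all add: ij m\<close>)
      then show ?thesis
        using True m(6) by (simp add: ij evolve_def add.commute)
    next
      case False
      then have m: "(i + j + s) mod 2 = 1" "(i + j + (s + 1)) mod 2 = 0" by presburger+
      show ?thesis
        using lim[OF f'(2)] False m by (simp add: ij evolve_def)
    qed
  qed
  then have "limitin sphere_top (\<lambda>n. Some (finite_ratio \<phi> (Suc k) c (b' n))) (x (s + int (Suc k) + 1) c) sequentially"
    using finite_ratio_Suc[OF par Suc.prems(1) gen] by (simp add: algebra_simps)
  moreover have "(\<lambda>n. dist (finite_ratio \<phi> (Suc k) c (b n)) (finite_ratio \<phi> (Suc k) c (b' n))) \<longlonglongrightarrow> 0"
    using null[OF near'] by (simp add: dist_commute)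
  ultimately show ?case
    by (rule limitin_sphere_perturb)
qed

lemma admissible_sequence:
  assumes "kasteleyn k c \<phi>"
  obtains b where "\<And>n. admissible_weights \<phi> k c (b n)"
    and "\<And>f. f \<in> all_faces k c \<Longrightarrow> limitin sphere_top (\<lambda>n. Some (b n f)) (a f) sequentially"
proof -
  \<comment> \<open>Infinite weights are first approximated by n; admissibility is then obtained by
    a vanishing perturbation.\<close>
  define b0 where "b0 n f = (case a f of None \<Rightarrow> of_nat n | Some z \<Rightarrow> z)" for n :: nat and f
  have "\<exists>b. admissible_weights \<phi> k c b \<and> (\<forall>f\<in>all_faces k c. dist (b f) (b0 n f) < 1 / real (Suc n))" for n
    by (rule admissible_approx[OF assms, of "1 / real (Suc n)" "b0 n"]) (simp, blast)
  then obtain b where adm: "\<And>n. admissible_weights \<phi> k c (b n)"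
    and near: "\<And>n f. f \<in> all_faces k c \<Longrightarrow> dist (b n f) (b0 n f) < 1 / real (Suc n)"
    by metis
  have "limitin sphere_top (\<lambda>n. Some (b n f)) (a f) sequentially" if f: "f \<in> all_faces k c" for f
  proof (rule limitin_sphere_perturb)
    show "limitin sphere_top (\<lambda>n. Some (b0 n f)) (a f) sequentially"
      by (cases "a f") (simp_all add: b0_def limitin_sphere_None limitin_sphere_Some tendsto_of_nat)
    show "(\<lambda>n. dist (b n f) (b0 n f)) \<longlonglongrightarrow> 0"
      by (rule tendsto_sandwich[OF _ _ tendsto_const LIMSEQ_Suc[OF lim_1_over_n]])
        (use near[OF f] in \<open>auto intro!: always_eventually less_imp_le\<close>)
  qed
  then show thesis using that adm by blast
qed

text \<open>Convergence along every admissible sequence shows that the value fits the description in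
  \<open>ratio_function\<close>. That no other value fits needs one such sequence and the Hausdorff
  property.\<close>

lemma ratio_function_dskp:
  fixes x :: "int \<Rightarrow> face \<Rightarrow> sphere"
  assumes x: "\<And>t i j. even (i + j + t) \<Longrightarrow>
      sphere_dskp (x t (i, j)) (x (t + 1) (i, j + 1)) (x (t + 1) (i + 1, j))
        (x (t + 1) (i, j - 1)) (x (t + 1) (i - 1, j)) (x (t + 2) (i, j))"
    and \<phi>: "kasteleyn k c \<phi>" and par: "even (fst c + snd c + int k + 1)"
  shows "ratio_function \<phi> k c (\<lambda>f. x ((fst f + snd f) mod 2) f) = x (int k + 1) c"
proof (cases "k = 0")
  case True
  then have "(fst c + snd c) mod 2 = 1" using par by simp presburger
  then show ?thesis using True by (simp add: ratio_function_def)
next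
  case False
  let ?a = "\<lambda>f. x ((fst f + snd f) mod 2) f"
  have lim: "limitin sphere_top (\<lambda>n. Some (finite_ratio \<phi> k c (b n))) (x (int k + 1) c) sequentially"
    if "\<forall>n. admissible_weights \<phi> k c (b n)"
      "\<forall>f\<in>all_faces k c. limitin sphere_top (\<lambda>n. Some (b n f)) (?a f) sequentially" for b
    using limit_finite_ratio[OF x \<phi>, of 0 b] par that by simp
  have "(THE y. \<forall>b. (\<forall>n. admissible_weights \<phi> k c (b n)) \<and>
        (\<forall>f\<in>all_faces k c. limitin sphere_top (\<lambda>n. Some (b n f)) (?a f) sequentially)
        \<longrightarrow> limitin sphere_top (\<lambda>n. Some (finite_ratio \<phi> k c (b n))) y sequentially) = x (int k + 1) c"
  proof (rule the_equality, goal_cases)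
    case 1
    show ?case using lim by blast
  next
    case (2 y)
    obtain b where b: "\<And>n. admissible_weights \<phi> k c (b n)"
      "\<And>f. f \<in> all_faces k c \<Longrightarrow> limitin sphere_top (\<lambda>n. Some (b n f)) (?a f) sequentially"
      using admissible_sequence[OF \<phi>, of ?a] by blast
    then have "limitin sphere_top (\<lambda>n. Some (finite_ratio \<phi> k c (b n))) y sequentially"
      using 2 by blast
    moreover have "limitin sphere_top (\<lambda>n. Some (finite_ratio \<phi> k c (b n))) (x (int k + 1) c) sequentially"
      using lim b by blast
    ultimately show ?case
      using limitin_Hausdorff_unique[OF _ _ _ Hausdorff_sphere_top] trivial_limit_sequentially
      by blast
  qed
  then show ?thesis using False by (simp add: ratio_function_def)
qed


subsection \<open>Baecklund pairs as solutions of the dSKP equation\<close>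

lemma cr_eq_SomeD:
  assumes "cr a b c d = Some l"
  shows "hdiff a b * hdiff c d = l * (hdiff b c * hdiff d a)" and "b \<noteq> c" "d \<noteq> a"
    and "l \<noteq> 0 \<Longrightarrow> a \<noteq> b" "l \<noteq> 0 \<Longrightarrow> c \<noteq> d"
proof -
  have ne: "hdiff b c * hdiff d a \<noteq> 0" and l: "l = (hdiff a b * hdiff c d) / (hdiff b c * hdiff d a)"
    using assms by (auto simp: cr_def split: if_splits)
  show "hdiff a b * hdiff c d = l * (hdiff b c * hdiff d a)" using ne l by simp
  show "b \<noteq> c" "d \<noteq> a" using ne by (auto simp: hdiff_eq_0_iff)
  show "l \<noteq> 0 \<Longrightarrow> a \<noteq> b" "l \<noteq> 0 \<Longrightarrow> c \<noteq> d" using l by (auto simp: hdiff_def)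
qed

text \<open>Exchanging z and w reads the mixed faces in reverse order, so this symmetry makes the
  two maps of a pair interchangeable.\<close>

lemma cr_reverse: "cr d c b a = cr a b c d"
proof -
  have "hdiff c b * hdiff a d = hdiff b c * hdiff d a" "hdiff d c * hdiff b a = hdiff a b * hdiff c d"
    using hdiff_commute[of b c] hdiff_commute[of d a] hdiff_commute[of c d] hdiff_commute[of a b] by simp_all
  then show ?thesis by (simp add: cr_def)
qed

lemma baecklund_pair_swap: "baecklund_pair \<alpha> \<beta> \<gamma> z w \<Longrightarrow> baecklund_pair \<alpha> \<beta> \<gamma> w z"
  unfolding baecklund_pair_def using cr_reverse by metis

text \<open>Each edge at \<open>w m n\<close> occurs in two of the three cross-ratio equations, and
  these edges are eliminated together with the labels. As for \<open>ne\<close>, equality of the two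
  points would force cross-ratio 1, that is \<open>\<alpha> m = \<beta> n\<close>.\<close>

lemma baecklund_dskp:
  assumes \<alpha>: "\<And>m. \<alpha> m \<noteq> 0" and \<beta>: "\<And>m. \<beta> m \<noteq> 0" and \<gamma>: "\<gamma> \<noteq> 0"
    and zw: "baecklund_pair \<alpha> \<beta> \<gamma> z w" and ne: "w (m + 1) n \<noteq> w m (n + 1)"
  shows "sphere_dskp (z m n) (z (m + 1) n) (w (m + 1) n) (w m (n + 1)) (z m (n + 1)) (w (m + 1) (n + 1))"
proof -
  let ?a = "hdiff (z m n) (z (m + 1) n)" and ?b = "hdiff (w (m + 1) n) (w m n)"
    and ?c = "hdiff (z (m + 1) n) (w (m + 1) n)" and ?d = "hdiff (w m n) (z m n)"
    and ?e = "hdiff (z m n) (z m (n + 1))" and ?f = "hdiff (w m (n + 1)) (w m n)"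
    and ?g = "hdiff (z m (n + 1)) (w m (n + 1))" and ?h = "hdiff (w (m + 1) (n + 1)) (w m (n + 1))"
    and ?k = "hdiff (w (m + 1) n) (w (m + 1) (n + 1))"
  have cr1: "cr (z m n) (z (m + 1) n) (w (m + 1) n) (w m n) = Some (\<alpha> m / \<gamma>)"
    and cr2: "cr (z m n) (z m (n + 1)) (w m (n + 1)) (w m n) = Some (\<beta> n / \<gamma>)"
    and cr3: "cr (w m n) (w (m + 1) n) (w (m + 1) (n + 1)) (w m (n + 1)) = Some (\<alpha> m / \<beta> n)"
    using zw unfolding baecklund_pair_def integrable_cr_map_def by blast+
  have 1: "?a * ?b * \<gamma> = \<alpha> m * (?c * ?d)"
    using cr_eq_SomeD(1)[OF cr1] \<gamma> by (simp add: field_simps)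
  have 2: "?e * ?f * \<gamma> = \<beta> n * (?g * ?d)"
    using cr_eq_SomeD(1)[OF cr2] \<gamma> by (simp add: field_simps)
  have 3: "- ?b * ?h * \<beta> n = \<alpha> m * (?k * ?f)"
    using cr_eq_SomeD(1)[OF cr3] \<beta>[of n] hdiff_commute[of "w (m + 1) n" "w m n"] by (simp add: field_simps)
  have d: "?d \<noteq> 0" using cr_eq_SomeD(3)[OF cr1] by (simp add: hdiff_eq_0_iff)
  have "\<alpha> m * \<beta> n * ?d * (?c * ?e * ?h) = (\<alpha> m * (?c * ?d)) * (?e * ?h * \<beta> n)" by simp
  also have "\<dots> = ?a * ?e * \<gamma> * (?b * ?h * \<beta> n)" unfolding 1[symmetric] by simp
  also have "?b * ?h * \<beta> n = - (\<alpha> m * (?k * ?f))" using 3 by algebra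
  also have "?a * ?e * \<gamma> * - (\<alpha> m * (?k * ?f)) = - (?a * \<alpha> m * ?k * (?e * ?f * \<gamma>))" by simp
  also have "\<dots> = \<alpha> m * \<beta> n * ?d * (- (?a * ?g * ?k))" unfolding 2 by simp
  finally have "\<alpha> m * \<beta> n * ?d * (?c * ?e * ?h) = \<alpha> m * \<beta> n * ?d * (- (?a * ?g * ?k))" .
  moreover have "\<alpha> m * \<beta> n * ?d \<noteq> 0" using \<alpha>[of m] \<beta>[of n] d by simp
  ultimately have "?c * ?e * ?h = - (?a * ?g * ?k)" by (metis mult_left_cancel)
  moreover have "hdiff (w (m + 1) n) (z (m + 1) n) = - ?c" "hdiff (w m (n + 1)) (w (m + 1) (n + 1)) = - ?h"
    "hdiff (z (m + 1) n) (z m n) = - ?a"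
    by (rule hdiff_commute)+
  moreover have "w (m + 1) n \<noteq> z (m + 1) n" using cr_eq_SomeD(2)[OF cr1] by simp
  moreover have "z m n \<noteq> z m (n + 1)" using cr_eq_SomeD(4)[OF cr2] \<beta>[of n] \<gamma> by simp
  ultimately show ?thesis
    unfolding sphere_dskp_def using ne by simp
qed

section \<open>The solution in time and its initial values\<close>

definition z_type :: "int \<Rightarrow> face \<Rightarrow> bool" where
  "z_type t f \<longleftrightarrow> (t mod 4 \<in> {0, 1} \<longleftrightarrow> (fst f - snd f) mod 4 \<in> {0, 3})"

text \<open>Time t = i + j and position u + v = i - j determine (i, j); the coordinate u - v decides
  between z and w, with a pattern that is flipped whenever t grows by 2.\<close>

definition dskp_solution ::
    "(int \<Rightarrow> int \<Rightarrow> sphere) \<Rightarrow> (int \<Rightarrow> int \<Rightarrow> sphere) \<Rightarrow> int \<Rightarrow> face \<Rightarrow> sphere" where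
  "dskp_solution z w t f =
     (if z_type t f then z else w) ((fst f + snd f + t) div 2) ((t - (fst f + snd f)) div 2)"

text \<open>The north and west neighbours have the type of c; the east and south neighbours and c'
  have the other one. This is how z and w are distributed over the six vertices in
  \<open>baecklund_dskp\<close>.\<close>

lemma z_type_neighbours:
  assumes "even (i + j + t)"
  shows "z_type (t + 1) (i, j + 1) \<longleftrightarrow> z_type t (i, j)" "z_type (t + 1) (i + 1, j) \<longleftrightarrow> \<not> z_type t (i, j)"
    "z_type (t + 1) (i, j - 1) \<longleftrightarrow> \<not> z_type t (i, j)" "z_type (t + 1) (i - 1, j) \<longleftrightarrow> z_type t (i, j)"
    "z_type (t + 2) (i, j) \<longleftrightarrow> \<not> z_type t (i, j)"
proof -
  have d: "even (t + (i - j))" using assms by presburger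
  define d where "d = i - j"
  have e: "i - (j + 1) = d - 1" "i + 1 - j = d + 1" "i - (j - 1) = d + 1" "i - 1 - j = d - 1"
    by (simp_all add: d_def)
  have t: "t mod 4 = 0 \<or> t mod 4 = 1 \<or> t mod 4 = 2 \<or> t mod 4 = 3" and
    dm: "d mod 4 = 0 \<or> d mod 4 = 1 \<or> d mod 4 = 2 \<or> d mod 4 = 3"
    by presburger+
  have par: "even (t mod 4 + d mod 4)" using d unfolding d_def[symmetric] by presburger
  have mt: "(t + 1) mod 4 \<in> {0, 1} \<longleftrightarrow> t mod 4 = 0 \<or> t mod 4 = 3"
    "(t + 2) mod 4 \<in> {0, 1} \<longleftrightarrow> t mod 4 = 2 \<or> t mod 4 = 3"
    using t unfolding mod_add_left_eq[of t 4 1, symmetric] mod_add_left_eq[of t 4 2, symmetric]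
    by (elim disjE; simp)+
  have md: "(d + 1) mod 4 \<in> {0, 3} \<longleftrightarrow> d mod 4 = 2 \<or> d mod 4 = 3"
    "(d - 1) mod 4 \<in> {0, 3} \<longleftrightarrow> d mod 4 = 0 \<or> d mod 4 = 1"
    using dm unfolding mod_add_left_eq[of d 4 1, symmetric] mod_diff_left_eq[of d 4 1, symmetric]
    by (elim disjE; simp)+
  show "z_type (t + 1) (i, j + 1) \<longleftrightarrow> z_type t (i, j)" "z_type (t + 1) (i + 1, j) \<longleftrightarrow> \<not> z_type t (i, j)"
    "z_type (t + 1) (i, j - 1) \<longleftrightarrow> \<not> z_type t (i, j)" "z_type (t + 1) (i - 1, j) \<longleftrightarrow> z_type t (i, j)"
    "z_type (t + 2) (i, j) \<longleftrightarrow> \<not> z_type t (i, j)"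
    unfolding z_type_def fst_conv snd_conv e d_def[symmetric] mt md
    using t dm par by (elim disjE; simp)+
qed

lemma dskp_solution_dskp:
  assumes \<alpha>: "\<And>m. \<alpha> m \<noteq> 0" and \<beta>: "\<And>m. \<beta> m \<noteq> 0" and \<gamma>: "\<gamma> \<noteq> 0"
    and zw: "baecklund_pair \<alpha> \<beta> \<gamma> z w"
    and z: "\<And>m n. z (m + 1) n \<noteq> z m (n + 1)" and w: "\<And>m n. w (m + 1) n \<noteq> w m (n + 1)"
    and par: "even (i + j + t)"
  shows "sphere_dskp (dskp_solution z w t (i, j)) (dskp_solution z w (t + 1) (i, j + 1))
    (dskp_solution z w (t + 1) (i + 1, j)) (dskp_solution z w (t + 1) (i, j - 1))
    (dskp_solution z w (t + 1) (i - 1, j)) (dskp_solution z w (t + 2) (i, j))"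
proof -
  \<comment> \<open>Face and time fix the lattice point (m, n) by i + j = m - n and t = m +
    n.\<close>
  obtain m where m: "i + j + t = 2 * m" using par by (rule evenE)
  define n where "n = t - m"
  have e: "i + j + t = 2 * m" "t - (i + j) = 2 * n"
    "i + (j + 1) + (t + 1) = 2 * (m + 1)" "t + 1 - (i + (j + 1)) = 2 * n"
    "i + 1 + j + (t + 1) = 2 * (m + 1)" "t + 1 - (i + 1 + j) = 2 * n"
    "i + (j - 1) + (t + 1) = 2 * m" "t + 1 - (i + (j - 1)) = 2 * (n + 1)"
    "i - 1 + j + (t + 1) = 2 * m" "t + 1 - (i - 1 + j) = 2 * (n + 1)"
    "i + j + (t + 2) = 2 * (m + 1)" "t + 2 - (i + j) = 2 * (n + 1)"
    using m unfolding n_def by presburger+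
  have half: "2 * a div 2 = a" for a :: int by simp
  note n1 = baecklund_dskp[of \<alpha> \<beta> \<gamma> z w m n, OF \<alpha> \<beta> \<gamma> zw w]
  \<comment> \<open>If c carries a value of w, the roles of z and w are exchanged.\<close>
  note n2 = baecklund_dskp[of \<alpha> \<beta> \<gamma> w z m n, OF \<alpha> \<beta> \<gamma> baecklund_pair_swap[OF zw] z]
  show ?thesis
  proof (cases "z_type t (i, j)")
    case True
    then show ?thesis
      unfolding dskp_solution_def fst_conv snd_conv e half z_type_neighbours[OF par] using n1 by simp
  next
    case False
    then show ?thesis
      unfolding dskp_solution_def fst_conv snd_conv e half z_type_neighbours[OF par] using n2 by simp
  qed
qed

text \<open>The initial weights are the solution at time 0 on the faces with i + j even and at time
  1 on the others.\<close>

lemma baecklund_weights_eq: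
  "baecklund_weights z w = (\<lambda>f. dskp_solution z w ((fst f + snd f) mod 2) f)"
proof
  fix f :: face
  obtain i j where f: "f = (i, j)" by (cases f)
  have t: "(i + j) mod 2 mod 4 \<in> {0, 1}" unfolding insert_iff empty_iff by presburger
  have q: "- (i + j) + (i + j) mod 2 = (i + j) mod 2 - (i + j)" by simp
  show "baecklund_weights z w f = dskp_solution z w ((fst f + snd f) mod 2) f"
    unfolding f baecklund_weights.simps dskp_solution_def z_type_def Let_def fst_conv snd_conv q
    using t by simp
qed

theorem theorem5p4:
  fixes \<alpha> \<beta> :: "int \<Rightarrow> complex" and \<gamma> :: complex
    and z w :: "int \<Rightarrow> int \<Rightarrow> sphere"
    and i j :: int and cz cw :: face and \<phi>z \<phi>w :: "dart \<Rightarrow> int"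
  assumes "\<And>m. \<alpha> m \<noteq> 0" and "\<And>m. \<beta> m \<noteq> 0" and "\<gamma> \<noteq> 0"
    and "baecklund_pair \<alpha> \<beta> \<gamma> z w"
    and generic_z: "\<And>m n. z (m+1) n \<noteq> z m (n+1)"
    and generic_w: "\<And>m n. w (m+1) n \<noteq> w m (n+1)"
    and "i + j \<ge> 1"
    and "cz \<in> z_faces (i - j)" and "cw \<in> w_faces (i - j)"
    and "kasteleyn (nat (i + j - 1)) cz \<phi>z" and "kasteleyn (nat (i + j - 1)) cw \<phi>w"
  shows "z i j = (if (i + j) mod 4 \<in> {0, 1}
            then ratio_function \<phi>z (nat (i + j - 1)) cz (baecklund_weights z w)
            else ratio_function \<phi>w (nat (i + j - 1)) cw (baecklund_weights z w)) \<and>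
         w i j = (if (i + j) mod 4 \<in> {2, 3}
            then ratio_function \<phi>z (nat (i + j - 1)) cz (baecklund_weights z w)
            else ratio_function \<phi>w (nat (i + j - 1)) cw (baecklund_weights z w))"
proof -
  let ?k = "nat (i + j - 1)" and ?x = "dskp_solution z w"
  \<comment> \<open>Initial data occupy the times 0 and 1, so a diamond of size k reaches time k +
    1.\<close>
  have k: "int ?k + 1 = i + j" using assms(7) by simp
  have ratio: "ratio_function \<phi> ?k c (baecklund_weights z w) = ?x (i + j) c"
    if "kasteleyn ?k c \<phi>" "fst c + snd c = i - j" for \<phi> c
  proof -
    have "fst c + snd c + int ?k + 1 = 2 * i" using k that(2) by linarith
    then have "even (fst c + snd c + int ?k + 1)" by simp
    then have "ratio_function \<phi> ?k c (\<lambda>f. ?x ((fst f + snd f) mod 2) f) = ?x (int ?k + 1) c"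
      by (intro ratio_function_dskp that(1) dskp_solution_dskp[of \<alpha> \<beta> \<gamma> z w] assms(1-4) generic_z generic_w)
    then show ?thesis unfolding baecklund_weights_eq k .
  qed
  have div: "(i - j + (i + j)) div 2 = i" "(i + j - (i - j)) div 2 = j" by simp_all
  have cz: "fst cz + snd cz = i - j" "(fst cz - snd cz) mod 4 \<in> {0, 3}"
    using assms(8) by (auto simp: z_faces_def)
  have cw: "fst cw + snd cw = i - j" "(fst cw - snd cw) mod 4 \<notin> {0, 3}"
    using assms(9) by (auto simp: w_faces_def)
  \<comment> \<open>At times with residue 2 or 3 modulo 4 the pattern is opposite to the initial
    one, so a face labelled z then carries a value of w, and conversely.\<close>
  have "?x (i + j) cz = (if (i + j) mod 4 \<in> {0, 1} then z i j else w i j)"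
    unfolding dskp_solution_def z_type_def cz(1) div using cz(2) by simp
  moreover have "?x (i + j) cw = (if (i + j) mod 4 \<in> {0, 1} then w i j else z i j)"
    unfolding dskp_solution_def z_type_def cw(1) div using cw(2) by simp
  moreover have "(i + j) mod 4 \<in> {2, 3} \<longleftrightarrow> (i + j) mod 4 \<notin> {0, 1}" by auto
  ultimately show ?thesis
    using ratio[OF assms(10) cz(1)] ratio[OF assms(11) cw(1)] by simp
qed

end
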